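(* Let $w,v\in F_2$. If $w$ is a root word, $w \sim v$, and $|w| = |v|$, then $v$ is a root word.
   Context: $F_2$ is the free group on generators $a,b$; $\overline{x}$ denotes the inverse of $x$, and $L_2=\{a,b,\overline{a},\overline{b}\}$ is the set of letters. Each element of $F_2$ is identified with its freely reduced word over $L_2$, and $|w|$ is the length of that word. Write $w\sim v$ if $\phi(w)=v$ for some $\phi\in\operatorname{Aut}F_2$. $C_2$ is the set of cyclically reduced words: $w=w_1\cdots w_\ell\in F_2$ with $w_\ell\neq\overline{w_1}$ (the empty word is included). A word $w\in F_2$ is minimal if $|w|\le|\phi(w)|$ for all $\phi\in\operatorname{Aut}F_2$ (every minimal word lies in $C_2$). Child: for nonempty $w=w_1\cdots w_\ell\in C_2$ and $1\le i\le\ell$, the word $w_1\cdots w_{i-1}w_iw_iw_{i+1}\cdots w_\ell$ is a child of $w$. Words are regarded here as cyclic words: $u\in C_2$ is a child of $w$ if some cyclic rotation of $u$ is obtained in this way from some cyclic rotation of $w$. In addition, each letter $x\in L_2$ is a child of the empty word. A root word is a minimal word that is not a child of any minimal word. *)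

theory Defs
  imports "HOL-Algebra.Group"
begin

datatype letter = La | Lb | La_inv | Lb_inv

type_synonym word = "letter list"

fun linv :: "letter \<Rightarrow> letter" where
  "linv La = La_inv"
| "linv Lb = Lb_inv"
| "linv La_inv = La"
| "linv Lb_inv = Lb"

definition reduced :: "word \<Rightarrow> bool" where
  "reduced w \<longleftrightarrow> successively (\<lambda>x y. y \<noteq> linv x) w"

fun lcons :: "letter \<Rightarrow> word \<Rightarrow> word" where
  "lcons x [] = [x]"
| "lcons x (y # ys) = (if y = linv x then ys else x # y # ys)"

definition reduce :: "word \<Rightarrow> word" where
  "reduce w = foldr lcons w []"

definition F2 :: "word monoid" where
  "F2 = \<lparr>carrier = {w. reduced w}, mult = (\<lambda>u v. reduce (u @ v)), one = []\<rparr>"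

definition aut_equiv :: "word \<Rightarrow> word \<Rightarrow> bool" where
  "aut_equiv w v \<longleftrightarrow> (\<exists>\<phi>\<in>iso F2 F2. \<phi> w = v)"

definition C2 :: "word set" where
  "C2 = {w \<in> carrier F2. w \<noteq> [] \<longrightarrow> last w \<noteq> linv (hd w)}"

definition minimal :: "word \<Rightarrow> bool" where
  "minimal w \<longleftrightarrow> w \<in> carrier F2 \<and> (\<forall>\<phi>\<in>iso F2 F2. length w \<le> length (\<phi> w))"

text \<open>Positions are counted from 0, so \<open>double_at i w\<close> repeats the letter \<open>w\<^sub>i\<^sub>+\<^sub>1\<close>
  of \<open>w = w\<^sub>1 \<dots> w\<^sub>\<ell>\<close>.\<close>

definition double_at :: "nat \<Rightarrow> word \<Rightarrow> word" where
  "double_at i w = take i w @ w ! i # drop i w"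

definition is_child :: "word \<Rightarrow> word \<Rightarrow> bool" where
  "is_child u w \<longleftrightarrow> u \<in> C2 \<and> w \<in> C2 \<and>
     (if w = [] then \<exists>x. u = [x]
      else \<exists>m n i. i < length w \<and> rotate m u = double_at i (rotate n w))"

definition root_word :: "word \<Rightarrow> bool" where
  "root_word w \<longleftrightarrow> minimal w \<and> \<not> (\<exists>v. minimal v \<and> is_child w v)"


text \<open>\<open>F2\<close> is a group and is free on \<open>[La]\<close> and \<open>[Lb]\<close>.\<close>

lemma linv_linv [simp]: "linv (linv x) = x"
  by (cases x) auto

lemma linv_neq [simp]: "linv x \<noteq> x" "x \<noteq> linv x"
  by (cases x; simp)+

lemma reduced_Nil [simp]: "reduced []"
  by (simp add: reduced_def)

lemma reduced_Cons: "reduced (x # w) \<longleftrightarrow> reduced w \<and> (w \<noteq> [] \<longrightarrow> hd w \<noteq> linv x)"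
  by (cases w) (auto simp: reduced_def)

lemma reduced_lcons: "reduced w \<Longrightarrow> reduced (lcons x w)"
  by (cases w) (auto simp: reduced_Cons)

lemma reduced_foldr_lcons: "reduced v \<Longrightarrow> reduced (foldr lcons u v)"
  by (induction u) (auto simp: reduced_lcons)

lemma reduced_reduce: "reduced (reduce w)"
  by (simp add: reduce_def reduced_foldr_lcons)

lemma lcons_lcons_linv: "reduced w \<Longrightarrow> lcons x (lcons (linv x) w) = w"
  by (cases w; cases "tl w") (auto simp: reduced_Cons)

lemma reduce_reduced: "reduced w \<Longrightarrow> reduce w = w"
proof (induction w)
  case (Cons x w)
  then show ?case by (cases w) (auto simp: reduce_def reduced_Cons)
qed (simp add: reduce_def)

lemma foldr_lcons_lcons:
  assumes "reduced v"
  shows "foldr lcons (lcons x u) v = lcons x (foldr lcons u v)"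
  by (cases u) (auto simp: lcons_lcons_linv reduced_foldr_lcons assms)

lemma foldr_lcons_reduce: "reduced v \<Longrightarrow> foldr lcons (reduce u) v = foldr lcons u v"
  by (induction u) (auto simp: reduce_def foldr_lcons_lcons)

lemma mult_F2: "reduced v \<Longrightarrow> u \<otimes>\<^bsub>F2\<^esub> v = foldr lcons u v"
  using reduce_reduced[of v] by (simp add: F2_def reduce_def)

lemma carrier_F2: "carrier F2 = {w. reduced w}"
  by (simp add: F2_def)

lemma one_F2: "\<one>\<^bsub>F2\<^esub> = []"
  by (simp add: F2_def)

lemma foldr_lcons_inv: "reduced v \<Longrightarrow> foldr lcons (rev (map linv w)) (foldr lcons w v) = v"
proof (induction w arbitrary: v)
  case (Cons x w)
  have "lcons (linv x) (lcons x z) = z" if "reduced z" for z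
    using lcons_lcons_linv[OF that, of "linv x"] by simp
  then show ?case using Cons by (simp add: reduced_foldr_lcons)
qed simp

lemma group_F2: "group F2"
proof (rule groupI)
  fix x y z assume "x \<in> carrier F2" "y \<in> carrier F2" "z \<in> carrier F2"
  then have r: "reduced x" "reduced y" "reduced z" by (auto simp: carrier_F2)
  have "foldr lcons (foldr lcons x y) z = foldr lcons (reduce (x @ y)) z"
    using reduce_reduced[OF r(2)] by (simp add: reduce_def)
  also have "\<dots> = foldr lcons x (foldr lcons y z)"
    using r by (simp add: foldr_lcons_reduce)
  finally show "x \<otimes>\<^bsub>F2\<^esub> y \<otimes>\<^bsub>F2\<^esub> z = x \<otimes>\<^bsub>F2\<^esub> (y \<otimes>\<^bsub>F2\<^esub> z)"
    using r by (simp add: mult_F2 reduced_foldr_lcons)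
next
  fix x assume "x \<in> carrier F2"
  then have r: "reduced x" by (simp add: carrier_F2)
  let ?y = "reduce (rev (map linv x))"
  have "?y \<otimes>\<^bsub>F2\<^esub> x = foldr lcons (rev (map linv x)) (foldr lcons x [])"
    using r reduce_reduced[OF r] by (simp add: mult_F2 foldr_lcons_reduce reduce_def[symmetric])
  then have "?y \<otimes>\<^bsub>F2\<^esub> x = \<one>\<^bsub>F2\<^esub>"
    by (simp add: foldr_lcons_inv one_F2)
  then show "\<exists>y\<in>carrier F2. y \<otimes>\<^bsub>F2\<^esub> x = \<one>\<^bsub>F2\<^esub>"
    using reduced_reduce[of "rev (map linv x)"] unfolding carrier_F2 by blast
qed (auto simp: carrier_F2 one_F2 mult_F2 reduced_foldr_lcons F2_def reduced_reduce reduce_reduced)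

lemma F2_free_exists:
  assumes "group G" "x \<in> carrier G" "y \<in> carrier G"
  shows "\<exists>h\<in>hom F2 G. h [La] = x \<and> h [Lb] = y"
proof -
  interpret group G by fact
  define f where "f l = (case l of La \<Rightarrow> x | Lb \<Rightarrow> y | La_inv \<Rightarrow> inv\<^bsub>G\<^esub> x | Lb_inv \<Rightarrow> inv\<^bsub>G\<^esub> y)" for l
  define h where "h w = foldr (\<lambda>l g. f l \<otimes>\<^bsub>G\<^esub> g) w \<one>\<^bsub>G\<^esub>" for w
  have f: "f l \<in> carrier G" for l
    using assms by (cases l) (auto simp: f_def)
  have f_inv: "f (linv l) = inv\<^bsub>G\<^esub> (f l)" for l
    using assms by (cases l) (auto simp: f_def)
  have h: "h w \<in> carrier G" for w
    by (induction w) (auto simp: h_def f)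
  have h_Cons: "h (l # w) = f l \<otimes>\<^bsub>G\<^esub> h w" for l w
    by (simp add: h_def)
  have h_lcons: "h (lcons l w) = f l \<otimes>\<^bsub>G\<^esub> h w" for l w
  proof (cases w)
    case (Cons k w')
    have "f l \<otimes>\<^bsub>G\<^esub> (inv\<^bsub>G\<^esub> (f l) \<otimes>\<^bsub>G\<^esub> h w') = h w'"
      using f h by (simp add: m_assoc[symmetric])
    with Cons show ?thesis by (auto simp: h_Cons f_inv)
  qed (simp add: h_def)
  have "h (foldr lcons u v) = h u \<otimes>\<^bsub>G\<^esub> h v" for u v
  proof (induction u)
    case Nil
    show ?case using h[of v] by (simp add: h_def[of "[]"])
  next
    case (Cons l u)
    then show ?case using f h by (simp add: h_lcons h_Cons m_assoc)
  qed
  then have "h \<in> hom F2 G"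
    using h by (auto simp: hom_def mult_F2 carrier_F2)
  moreover have "h [La] = x" "h [Lb] = y"
    using assms by (simp_all add: h_def f_def)
  ultimately show ?thesis by blast
qed

lemma F2_free_unique:
  assumes "group G" "g \<in> hom F2 G" "h \<in> hom F2 G"
    and eq: "g [La] = h [La]" "g [Lb] = h [Lb]" and "w \<in> carrier F2"
  shows "g w = h w"
proof -
  interpret g: group_hom F2 G g
    using assms group_F2 by (simp add: group_hom_def group_hom_axioms_def)
  interpret h: group_hom F2 G h
    using assms group_F2 by (simp add: group_hom_def group_hom_axioms_def)
  have L: "[l] \<in> carrier F2" for l
    by (simp add: carrier_F2 reduced_Cons)
  have inv: "[linv l] = inv\<^bsub>F2\<^esub> [l]" for l
    by (rule g.G.inv_equality[symmetric])
      (simp_all add: L, simp add: mult_F2 reduced_Cons one_F2)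
  have letter: "g [l] = h [l]" for l
    using inv[of La] inv[of Lb] eq by (cases l) (auto simp: L)
  have "reduced w \<Longrightarrow> g w = h w"
  proof (induction w)
    case Nil
    show ?case using g.hom_one h.hom_one by (simp add: one_F2)
  next
    case (Cons l w)
    have c: "w \<in> carrier F2" using Cons.prems by (simp add: carrier_F2 reduced_Cons)
    have "l # w = [l] \<otimes>\<^bsub>F2\<^esub> w"
      using Cons.prems by (cases w) (auto simp: mult_F2 reduced_Cons)
    moreover have "g w = h w"
      using Cons by (simp add: reduced_Cons)
    ultimately show ?case
      using c L[of l] letter[of l] by simp
  qed
  then show ?thesis using assms by (simp add: carrier_F2)
qed

end

theory Submission
  imports Defs
begin

text \<open>
  Up to conjugation and inversion of basis elements, the bases of \<open>F2\<close> are the edges of the Farey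
  triangulation: the edge \<open>{a, b}\<close> lies in the two triangles \<open>{a, b, ab}\<close> and \<open>{a, b, ab\<^sup>-\<^sup>1}\<close>. A fixed
  element of \<open>F2\<close> gives every edge a length, namely the length of the cyclic word that spells the
  element in this basis. For a cyclic word, let \<open>A\<close> be the number of adjacent pairs \<open>aa\<close>, let \<open>B\<close> be
  the number of pairs \<open>bb\<close>, and let \<open>d\<close> be the number of pairs \<open>ab\<close> minus the number of pairs
  \<open>ab\<^sup>-\<^sup>1\<close>, where a pair and its inverse are counted together. Passing from \<open>{a, b}\<close> to the two other
  edges of one triangle changes the length by \<open>A + d\<close> and \<open>B + d\<close>; for the other triangle the
  changes are \<open>A - d\<close> and \<open>B - d\<close> (\<open>gain_C2\<close>).

  The numbers \<open>A\<close> and \<open>B\<close> are nonnegative, and this makes the length convex. If the step that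
  arrived at an edge did not shorten the word, then the step back does not lengthen it, say
  \<open>A - d \<le> 0\<close>; hence \<open>d \<ge> A \<ge> 0\<close>, and both steps onward into the other triangle change the length by
  nonnegative amounts (\<open>ascending_nielsen\<close>). So along a path without backtracking the length never
  decreases again once it has failed to decrease. Every automorphism of \<open>F2\<close> is represented by such
  a path: by Nielsen's theorem the automorphisms are generated by letter symmetries, conjugations and
  \<open>a \<mapsto> ab\<close>, and cancelling the backtracking leaves a product of the positive substitutions \<open>a \<mapsto> ab\<close>
  and \<open>b \<mapsto> ba\<close> between two letter symmetries (\<open>iso_orbit\<close>).

  Two things follow. A cyclically reduced word is minimal if and only if no single step shortens it,
  that is, \<open>\<bar>d\<bar> \<le> A\<close> and \<open>\<bar>d\<bar> \<le> B\<close> (\<open>minimal_iff\<close>). And two minimal words of one orbit are joined by a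
  path of constant length. Doubling a letter raises one of \<open>A\<close> and \<open>B\<close> by one and changes nothing
  else, so a minimal word is a root word if and only if \<open>A = B = \<bar>d\<bar>\<close> (\<open>root_word_iff\<close>). This equation
  says that the word has the same length on all three edges of a triangle through \<open>{a, b}\<close>. A step
  of constant length from such an edge stays within such a triangle, so the property is handed on
  along the path (\<open>triangular_nielsen\<close>).
\<close>

section \<open>Reduced words as group elements\<close>

interpretation F2: group F2 by (rule group_F2)

abbreviation mul :: "word \<Rightarrow> word \<Rightarrow> word"  (infixl "\<cdot>" 70)
  where "u \<cdot> v \<equiv> u \<otimes>\<^bsub>F2\<^esub> v"

definition winv :: "word \<Rightarrow> word" where
  "winv w = rev (map linv w)"

lemma winv_simps [simp]:
  "winv [] = []" "winv (x # w) = winv w @ [linv x]" "winv (u @ v) = winv v @ winv u"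
  "length (winv w) = length w" "winv (winv w) = w"
  by (simp_all add: winv_def rev_map comp_def)

lemma winv_eq_Nil [simp]: "winv w = [] \<longleftrightarrow> w = []"
  by (simp add: winv_def)

lemma reduced_append:
  "reduced (u @ v) \<longleftrightarrow> reduced u \<and> reduced v \<and> (u \<noteq> [] \<and> v \<noteq> [] \<longrightarrow> hd v \<noteq> linv (last u))"
  by (auto simp: reduced_def successively_append_iff)

lemma linv_eq_iff: "linv x = y \<longleftrightarrow> x = linv y"
  by auto

lemma linv_inj [simp]: "linv x = linv y \<longleftrightarrow> x = y"
  by (metis linv_linv)

lemma reduced_winv [simp]: "reduced (winv w) \<longleftrightarrow> reduced w"
proof -
  have "reduced (winv w)" if "reduced w" for w
    using that by (induction w) (auto simp: reduced_append reduced_Cons winv_def last_rev hd_map)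
  then show ?thesis by (metis winv_simps(5))
qed

lemma reduce_append: "reduce (u @ v) = reduce u \<cdot> reduce v"
  using reduced_reduce[of v] by (simp add: mult_F2 foldr_lcons_reduce) (simp add: reduce_def)

lemma mul_closed [simp]: "reduced u \<Longrightarrow> reduced v \<Longrightarrow> reduced (u \<cdot> v)"
  using F2.m_closed by (simp add: carrier_F2)

lemma mul_eq_reduce: "reduced u \<Longrightarrow> reduced v \<Longrightarrow> u \<cdot> v = reduce (u @ v)"
  by (simp add: reduce_append reduce_reduced)

lemma mul_eq_append: "reduced (u @ v) \<Longrightarrow> u \<cdot> v = u @ v"
  by (metis mul_eq_reduce reduce_reduced reduced_append)

lemma mul_Nil [simp]: "reduced u \<Longrightarrow> u \<cdot> [] = u" "reduced u \<Longrightarrow> [] \<cdot> u = u"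
  using F2.r_one[of u] F2.l_one[of u] by (simp_all add: carrier_F2 one_F2)

lemma winv_mul [simp]: "reduced w \<Longrightarrow> winv w \<cdot> w = []"
  using foldr_lcons_inv[of "[]" w] reduce_reduced[of w]
  by (simp add: mult_F2 winv_def reduce_def)

lemma inv_F2: "reduced w \<Longrightarrow> inv\<^bsub>F2\<^esub> w = winv w"
  by (rule F2.inv_equality) (simp_all add: carrier_F2 one_F2)

lemma mul_winv [simp]: "reduced w \<Longrightarrow> w \<cdot> winv w = []"
  by (metis reduced_winv winv_mul winv_simps(5))

lemma mul_assoc: "reduced u \<Longrightarrow> reduced v \<Longrightarrow> reduced w \<Longrightarrow> u \<cdot> v \<cdot> w = u \<cdot> (v \<cdot> w)"
  by (rule F2.m_assoc) (simp_all add: carrier_F2)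

lemma winv_mul_cancel [simp]:
  "reduced u \<Longrightarrow> reduced w \<Longrightarrow> winv u \<cdot> (u \<cdot> w) = w"
  "reduced u \<Longrightarrow> reduced w \<Longrightarrow> u \<cdot> (winv u \<cdot> w) = w"
  by (simp_all flip: mul_assoc)

lemma winv_mul_distrib: "reduced u \<Longrightarrow> reduced v \<Longrightarrow> winv (u \<cdot> v) = winv v \<cdot> winv u"
  using F2.inv_mult_group[of u v] by (simp add: carrier_F2 inv_F2)

lemma length_foldr_lcons: "length (foldr lcons u v) \<le> length u + length v"
proof (induction u)
  case (Cons x u)
  have "length (lcons x z) \<le> Suc (length z)" for z by (cases z) auto
  with Cons show ?case by (simp, meson le_trans not_less_eq_eq)
qed simp

lemma length_mul: "reduced v \<Longrightarrow> length (u \<cdot> v) \<le> length u + length v"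
  by (simp add: mult_F2 length_foldr_lcons)

lemma set_mul: "reduced v \<Longrightarrow> set (u \<cdot> v) \<subseteq> set u \<union> set v"
proof -
  have "set (lcons x z) \<subseteq> insert x (set z)" for x z by (cases z) auto
  then have "set (foldr lcons u v) \<subseteq> set u \<union> set v" for u
    by (induct u) fastforce+
  then show "reduced v \<Longrightarrow> ?thesis" by (simp add: mult_F2)
qed

lemma cancellation:
  assumes "reduced u" "reduced v"
  obtains u' r v' where "u = u' @ r" "v = winv r @ v'" "reduced (u' @ v')" "u \<cdot> v = u' @ v'"
proof -
  have "\<exists>u' r v'. u = u' @ r \<and> v = winv r @ v' \<and> reduced (u' @ v') \<and> u \<cdot> v = u' @ v'"
    using assms
  proof (induction u arbitrary: v rule: rev_induct)
    case Nil
    then show ?case by simp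
  next
    case (snoc x u)
    show ?case
    proof (cases "reduced ((u @ [x]) @ v)")
      case True
      then show ?thesis using mul_eq_append[OF True] by (metis append_Nil append_Nil2 winv_simps(1))
    next
      case False
      then obtain w where v: "v = linv x # w"
        using snoc.prems by (cases v) (auto simp: reduced_append reduced_Cons)
      have r: "reduced u" "reduced w" "reduced [x]" "reduced [linv x]"
        using snoc.prems v by (auto simp: reduced_append reduced_Cons)
      obtain u' r v' where IH: "u = u' @ r" "w = winv r @ v'" "reduced (u' @ v')" "u \<cdot> w = u' @ v'"
        using snoc.IH r(1,2) by blast
      have "(u @ [x]) \<cdot> v = (u \<cdot> [x]) \<cdot> ([linv x] \<cdot> w)"
        using snoc.prems v mul_eq_append[of u "[x]"] mul_eq_append[of "[linv x]" w] by simp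
      also have "\<dots> = u \<cdot> w"
        using r winv_mul_cancel(2)[of "[x]" w] by (simp add: mul_assoc)
      finally show ?thesis
        using IH v by (intro exI[of _ u'] exI[of _ "r @ [x]"] exI[of _ v']) simp
    qed
  qed
  then show ?thesis using that by blast
qed

section \<open>Conjugacy and cyclic length\<close>

definition conj_by :: "word \<Rightarrow> word \<Rightarrow> word" where
  "conj_by g w = g \<cdot> w \<cdot> winv g"

definition conjugate :: "word \<Rightarrow> word \<Rightarrow> bool" where
  "conjugate u v \<longleftrightarrow> reduced u \<and> reduced v \<and> (\<exists>g. reduced g \<and> v = conj_by g u)"

lemma reduced_conj_by [simp]: "reduced g \<Longrightarrow> reduced w \<Longrightarrow> reduced (conj_by g w)"
  by (simp add: conj_by_def)

lemma conj_by_Nil [simp]: "reduced w \<Longrightarrow> conj_by [] w = w"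
  by (simp add: conj_by_def)

lemma conj_by_mul: "reduced g \<Longrightarrow> reduced h \<Longrightarrow> reduced w \<Longrightarrow> conj_by g (conj_by h w) = conj_by (g \<cdot> h) w"
  by (simp add: conj_by_def winv_mul_distrib mul_assoc)

lemma conj_by_hom: "reduced g \<Longrightarrow> reduced u \<Longrightarrow> reduced v \<Longrightarrow> conj_by g (u \<cdot> v) = conj_by g u \<cdot> conj_by g v"
  by (simp add: conj_by_def mul_assoc)

lemma conjugateI: "reduced g \<Longrightarrow> reduced u \<Longrightarrow> conjugate u (conj_by g u)"
  by (auto simp: conjugate_def)

lemma conjugate_refl [simp]: "conjugate u u \<longleftrightarrow> reduced u"
  by (metis conj_by_Nil conjugate_def reduced_Nil)

lemma conjugate_sym: "conjugate u v \<Longrightarrow> conjugate v u"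
  unfolding conjugate_def by (metis conj_by_Nil conj_by_mul reduced_winv winv_mul)

lemma conjugate_trans [trans]: "conjugate u v \<Longrightarrow> conjugate v w \<Longrightarrow> conjugate u w"
  unfolding conjugate_def by (metis conj_by_mul mul_closed)

lemma conjugate_reduced: "conjugate u v \<Longrightarrow> reduced u" "conjugate u v \<Longrightarrow> reduced v"
  by (auto simp: conjugate_def)

text \<open>The length of the cyclic word of \<open>w\<close>, defined so that invariance under conjugation is immediate.\<close>

definition cyclen :: "word \<Rightarrow> nat" where
  "cyclen w = (LEAST n. \<exists>u. conjugate w u \<and> length u = n)"

lemma cyclen_le: "conjugate w u \<Longrightarrow> cyclen w \<le> length u"
  unfolding cyclen_def by (rule Least_le) blast

lemma cyclen_conjugate: "conjugate u v \<Longrightarrow> cyclen u = cyclen v"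
proof -
  assume "conjugate u v"
  then have "conjugate u x \<longleftrightarrow> conjugate v x" for x by (meson conjugate_sym conjugate_trans)
  then show ?thesis by (simp add: cyclen_def)
qed

lemma cyclen_attained:
  assumes "reduced w" obtains u where "conjugate w u" "length u = cyclen w"
  using LeastI_ex[of "\<lambda>n. \<exists>u. conjugate w u \<and> length u = n"] assms that
  unfolding cyclen_def by (metis conjugate_refl)

text \<open>This form reduces questions about cyclic words to questions about linear ones: nothing has to be
  said about the junction of the last letter with the first.\<close>

lemma C2_iff_reduced_square: "w \<in> C2 \<longleftrightarrow> reduced (w @ w)"
  by (cases "w = []") (auto simp: C2_def carrier_F2 reduced_append linv_eq_iff)

lemma C2_reduced: "w \<in> C2 \<Longrightarrow> reduced w"
  by (simp add: C2_def carrier_F2)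

lemma strip_ends:
  assumes "reduced w" "w \<notin> C2"
  obtains u where "conjugate w u" "length u < length w"
proof -
  have "w \<noteq> []" "last w = linv (hd w)" using assms by (auto simp: C2_def carrier_F2)
  then obtain x m where w: "w = x # m @ [linv x]"
    by (metis append_butlast_last_id last_ConsL linv_neq(2) list.collapse last_tl list.sel(1) list.sel(3))
  then have r: "reduced m" "reduced [linv x]" "reduced [x]" "reduced ([x] @ m)" "reduced (([x] @ m) @ [linv x])" using assms
    by (auto simp: reduced_append reduced_Cons)
  have "w = ([x] \<cdot> m) \<cdot> [linv x]"
    using mul_eq_append[OF r(4)] mul_eq_append[OF r(5)] w by simp
  then have "w = conj_by [x] m" by (simp add: conj_by_def)
  then have "conjugate w m" using r conjugateI[of "[x]" m] conjugate_sym by simp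
  then show ?thesis using that w by simp
qed

text \<open>If \<open>u\<close> is cyclically reduced, then its powers are reduced as they stand. A conjugate \<open>v\<close> of \<open>u\<close>
  satisfies \<open>n \<bar>u\<bar> \<le> n \<bar>v\<bar> + 2 \<bar>g\<bar>\<close> for all \<open>n\<close>, with \<open>g\<close> the conjugating element, and a large \<open>n\<close>
  gives \<open>\<bar>u\<bar> \<le> \<bar>v\<bar>\<close>.\<close>

lemma cyclen_C2:
  assumes "u \<in> C2" shows "cyclen u = length u"
proof (rule antisym)
  show "cyclen u \<le> length u" using assms by (intro cyclen_le) (simp add: C2_reduced)
  obtain v where "conjugate u v" and v: "length v = cyclen u"
    using cyclen_attained assms C2_reduced by blast
  then obtain g where g: "reduced g" "u = conj_by g v" "reduced v"
    using conjugate_sym[of u v] by (auto simp: conjugate_def)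
  define pw where "pw z n = ((\<lambda>y. z \<cdot> y) ^^ n) []" for z n
  have ru: "reduced u" using assms C2_reduced by blast
  have rp: "reduced (pw v n)" for n by (induction n) (auto simp: pw_def g)
  have pu: "pw u n = concat (replicate n u) \<and> reduced (concat (replicate n u))" for n
  proof (induction n)
    case (Suc n)
    have "reduced (u @ concat (replicate n u))"
      using assms Suc ru by (cases n) (auto simp: C2_iff_reduced_square reduced_append)
    with Suc show ?case using mul_eq_append by (simp add: pw_def)
  qed (simp add: pw_def)
  have pc: "pw u n = conj_by g (pw v n)" for n
  proof (induction n)
    case 0 show ?case using g by (simp add: pw_def conj_by_def)
  next
    case (Suc n)
    then show ?case using g(2) g(1,3) rp[of n] by (simp add: pw_def conj_by_hom)
  qed
  have lp: "length (pw v n) \<le> n * length v" for n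
  proof (induction n)
    case (Suc n)
    then show ?case using length_mul[OF rp[of n], of v] by (simp add: pw_def)
  qed (simp add: pw_def)
  \<comment> \<open>the two sides of \<open>u\<^sup>n = g v\<^sup>n g\<^sup>-\<^sup>1\<close>\<close>
  have *: "n * length u \<le> 2 * length g + n * length v" for n
  proof -
    have "n * length u = length (pw u n)"
      using pu[of n] by (simp add: length_concat sum_list_replicate)
    also have "\<dots> \<le> length (g \<cdot> pw v n) + length g"
      unfolding pc conj_by_def using length_mul[of "winv g"] g by simp
    also have "\<dots> \<le> 2 * length g + length (pw v n)"
      using length_mul[OF rp, of g] by simp
    finally show ?thesis using lp[of n] by simp
  qed
  show "length u \<le> cyclen u"
  proof (rule ccontr)
    assume "\<not> ?thesis"
    then have "length u \<ge> Suc (length v)" using v by simp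
    \<comment> \<open>an exponent larger than \<open>2 \<bar>g\<bar>\<close> suffices\<close>
    then have "(2 * length g + 1) * Suc (length v) \<le> (2 * length g + 1) * length u"
      using mult_le_mono2 by blast
    with *[of "2 * length g + 1"] show False by simp
  qed
qed

lemma C2_representative:
  assumes "reduced w" obtains u where "u \<in> C2" "conjugate w u"
proof -
  obtain u where u: "conjugate w u" "length u = cyclen w" using cyclen_attained assms by blast
  have "u \<in> C2"
  proof (rule ccontr)
    assume "u \<notin> C2"
    then obtain x where "conjugate u x" "length x < length u"
      using strip_ends u conjugate_reduced by metis
    then show False using u cyclen_le conjugate_trans by (metis not_le)
  qed
  then show ?thesis using that u by blast
qed

lemma hom_mul: "h \<in> hom F2 F2 \<Longrightarrow> reduced u \<Longrightarrow> reduced v \<Longrightarrow> h (u \<cdot> v) = h u \<cdot> h v"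
  by (simp add: hom_mult carrier_F2)

lemma hom_reduced: "h \<in> hom F2 F2 \<Longrightarrow> reduced u \<Longrightarrow> reduced (h u)"
  by (auto simp: hom_def carrier_F2)

lemma group_hom_F2: "h \<in> hom F2 F2 \<Longrightarrow> group_hom F2 F2 h"
  by (simp add: group_hom_def group_hom_axioms_def F2.is_group)

lemma hom_winv: "h \<in> hom F2 F2 \<Longrightarrow> reduced u \<Longrightarrow> h (winv u) = winv (h u)"
  using group_hom.hom_inv[OF group_hom_F2, of h u] by (simp add: inv_F2 carrier_F2 hom_reduced)

lemma hom_Nil: "h \<in> hom F2 F2 \<Longrightarrow> h [] = []"
  using group_hom.hom_one[OF group_hom_F2, of h] by (simp add: one_F2)

lemma hom_conj_by: "h \<in> hom F2 F2 \<Longrightarrow> reduced g \<Longrightarrow> reduced u \<Longrightarrow> h (conj_by g u) = conj_by (h g) (h u)"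
  by (simp add: conj_by_def hom_mul hom_winv)

lemma hom_conjugate: "h \<in> hom F2 F2 \<Longrightarrow> conjugate u v \<Longrightarrow> conjugate (h u) (h v)"
  unfolding conjugate_def by (metis hom_conj_by hom_reduced)

lemma conj_by_in_hom: "reduced g \<Longrightarrow> conj_by g \<in> hom F2 F2"
  by (auto simp: hom_def carrier_F2 conj_by_hom)

lemma homs_conjugate_on_basis:
  assumes "h \<in> hom F2 F2" "k \<in> hom F2 F2" "reduced g"
    and "k [La] = conj_by g (h [La])" "k [Lb] = conj_by g (h [Lb])" "reduced w"
  shows "conjugate (h w) (k w)"
proof -
  have "conj_by g \<circ> h \<in> hom F2 F2"
    using assms conj_by_in_hom hom_compose by blast
  then have "k w = (conj_by g \<circ> h) w"
    using F2_free_unique[OF group_F2 assms(2)] assms by (simp add: carrier_F2)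
  then show ?thesis using assms hom_reduced by (simp add: conjugateI)
qed

section \<open>Letter symmetries and the Nielsen substitution\<close>

text \<open>Renamings of letters that respect inversion; there are eight of them. They are the automorphisms
  that permute the letters, and they preserve all lengths.\<close>

definition letter_sym :: "(letter \<Rightarrow> letter) \<Rightarrow> bool" where
  "letter_sym s \<longleftrightarrow> bij s \<and> (\<forall>x. s (linv x) = linv (s x))"

lemma letter_sym_linv: "letter_sym s \<Longrightarrow> s (linv x) = linv (s x)"
  by (simp add: letter_sym_def)

lemma letter_sym_inj: "letter_sym s \<Longrightarrow> inj s"
  by (simp add: letter_sym_def bij_is_inj)

lemma letter_sym_eq [simp]: "letter_sym s \<Longrightarrow> s x = s y \<longleftrightarrow> x = y"
  using letter_sym_inj by (simp add: inj_eq)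

lemma letter_sym_comp: "letter_sym s \<Longrightarrow> letter_sym t \<Longrightarrow> letter_sym (s \<circ> t)"
  by (simp add: letter_sym_def bij_comp)

lemma letter_sym_id: "letter_sym id"
  by (simp add: letter_sym_def)

lemma UNIV_letter: "(UNIV :: letter set) = {La, Lb, La_inv, Lb_inv}"
  by (auto intro: letter.exhaust)

instance letter :: finite
  by standard (simp add: UNIV_letter)

definition perm_of :: "letter \<Rightarrow> letter \<Rightarrow> letter \<Rightarrow> letter" where
  "perm_of x y l = (case l of La \<Rightarrow> x | Lb \<Rightarrow> y | La_inv \<Rightarrow> linv x | Lb_inv \<Rightarrow> linv y)"

lemma perm_of_simps [simp]:
  "perm_of x y La = x" "perm_of x y Lb = y" "perm_of x y La_inv = linv x" "perm_of x y Lb_inv = linv y"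
  by (simp_all add: perm_of_def)

lemma letter_sym_perm_of:
  assumes "y \<noteq> x" "y \<noteq> linv x" shows "letter_sym (perm_of x y)"
proof -
  have "inj (perm_of x y)"
  proof (rule injI)
    fix l m assume "perm_of x y l = perm_of x y m"
    then show "l = m" using assms by (cases l; cases m) (auto simp: linv_eq_iff)
  qed
  then have "bij (perm_of x y)" by (simp add: bij_def finite_UNIV_inj_surj)
  moreover have "perm_of x y (linv l) = linv (perm_of x y l)" for l by (cases l) auto
  ultimately show ?thesis by (simp add: letter_sym_def)
qed

lemma letter_sym_eq_perm_of:
  assumes "letter_sym s" obtains x y where "s = perm_of x y" "y \<noteq> x" "y \<noteq> linv x"
proof
  show "s = perm_of (s La) (s Lb)"
    using letter_sym_linv[OF assms, of La] letter_sym_linv[OF assms, of Lb]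
    by (auto simp: fun_eq_iff perm_of_def split: letter.split)
  show "s Lb \<noteq> s La" using assms by simp
  show "s Lb \<noteq> linv (s La)" using letter_sym_linv[OF assms, of La] letter_sym_eq[OF assms, of Lb La_inv] by auto
qed

lemma letter_sym_cases:
  assumes "letter_sym s"
  obtains "s = perm_of La Lb" | "s = perm_of La Lb_inv" | "s = perm_of La_inv Lb" | "s = perm_of La_inv Lb_inv"
    | "s = perm_of Lb La" | "s = perm_of Lb La_inv" | "s = perm_of Lb_inv La" | "s = perm_of Lb_inv La_inv"
proof -
  obtain x y where "s = perm_of x y" "y \<noteq> x" "y \<noteq> linv x" using letter_sym_eq_perm_of assms by blast
  then show ?thesis using that by (cases x; cases y) simp_all
qed

abbreviation swap :: "letter \<Rightarrow> letter" where "swap \<equiv> perm_of Lb La"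
abbreviation flip :: "letter \<Rightarrow> letter" where "flip \<equiv> perm_of La Lb_inv"

lemma letter_sym_swap [simp]: "letter_sym swap" and letter_sym_flip [simp]: "letter_sym flip"
  by (auto intro: letter_sym_perm_of)

lemma map_swap_swap [simp]: "map swap (map swap w) = w" and map_flip_flip [simp]: "map flip (map flip w) = w"
proof -
  have "swap (swap x) = x" "flip (flip x) = x" for x by (cases x; simp)+
  then show "map swap (map swap w) = w" "map flip (map flip w) = w" by (simp_all add: comp_def map_idI)
qed

lemma reduced_map: "letter_sym s \<Longrightarrow> reduced (map s w) \<longleftrightarrow> reduced w"
proof -
  assume s: "letter_sym s"
  have "(s x \<noteq> linv (s y)) \<longleftrightarrow> x \<noteq> linv y" for x y
    using s by (metis letter_sym_eq letter_sym_linv)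
  then show ?thesis by (simp add: reduced_def successively_map)
qed

lemma map_lcons: "letter_sym s \<Longrightarrow> map s (lcons x w) = lcons (s x) (map s w)"
  by (cases w) (auto, (metis letter_sym_eq letter_sym_linv)+)

lemma map_in_hom: "letter_sym s \<Longrightarrow> map s \<in> hom F2 F2"
proof -
  assume s: "letter_sym s"
  have "map s (foldr lcons u v) = foldr lcons (map s u) (map s v)" for u v
    by (induction u) (simp_all add: map_lcons s)
  then show ?thesis using s by (auto simp: hom_def carrier_F2 mult_F2 reduced_map)
qed

lemma map_C2: "letter_sym s \<Longrightarrow> map s w \<in> C2 \<longleftrightarrow> w \<in> C2"
  using reduced_map[of s "w @ w"] by (simp add: C2_iff_reduced_square)

lemma conjugate_map: "letter_sym s \<Longrightarrow> conjugate u v \<Longrightarrow> conjugate (map s u) (map s v)"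
  using hom_conjugate map_in_hom by blast

lemma cyclen_map: "letter_sym s \<Longrightarrow> reduced w \<Longrightarrow> cyclen (map s w) = cyclen w"
  by (metis C2_representative conjugate_map cyclen_C2 cyclen_conjugate length_map map_C2)

text \<open>Every elementary Nielsen automorphism is obtained from \<open>a \<mapsto> ab, b \<mapsto> b\<close> by composing with letter
  symmetries and conjugations, so this is the only one whose effect on words is analysed.\<close>

fun nielsen_letter :: "letter \<Rightarrow> word" where
  "nielsen_letter La = [La, Lb]" | "nielsen_letter Lb = [Lb]" | "nielsen_letter La_inv = [Lb_inv, La_inv]" | "nielsen_letter Lb_inv = [Lb_inv]"

definition nielsen :: "word \<Rightarrow> word" where
  "nielsen w = reduce (concat (map nielsen_letter w))"

lemma reduced_nielsen [simp]: "reduced (nielsen w)"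
  by (simp add: nielsen_def reduced_reduce)

lemma nielsen_letter_linv: "nielsen_letter (linv x) = winv (nielsen_letter x)" and reduced_nielsen_letter: "reduced (nielsen_letter x)"
  by (cases x; simp add: reduced_Cons)+

lemma nielsen_append: "nielsen (u @ v) = nielsen u \<cdot> nielsen v"
  by (simp add: nielsen_def reduce_append)

lemma nielsen_Cons: "nielsen (x # w) = nielsen_letter x \<cdot> nielsen w"
  using nielsen_append[of "[x]" w] by (simp add: nielsen_def reduce_reduced reduced_nielsen_letter)

lemma nielsen_in_hom: "nielsen \<in> hom F2 F2"
proof -
  have l: "nielsen (lcons x w) = nielsen_letter x \<cdot> nielsen w" for x w
    by (cases w) (simp_all add: nielsen_Cons nielsen_letter_linv reduced_nielsen_letter)
  have "nielsen (foldr lcons u v) = nielsen u \<cdot> nielsen v" for u v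
  proof (induction u)
    case Nil
    show ?case by (simp add: nielsen_def[of "[]"]) (simp add: reduce_def)
  next
    case (Cons x u)
    then show ?case by (simp add: l nielsen_Cons mul_assoc reduced_nielsen_letter)
  qed
  then show ?thesis by (auto simp: hom_def carrier_F2 mult_F2)
qed

text \<open>The inverse substitution \<open>a \<mapsto> ab\<^sup>-\<^sup>1\<close>, and the same two substitutions with \<open>a\<close> and \<open>b\<close> exchanged.\<close>

definition nielsen_inv :: "word \<Rightarrow> word" where
  "nielsen_inv w = map flip (nielsen (map flip w))"

definition nielsen_swap :: "word \<Rightarrow> word" where
  "nielsen_swap w = map swap (nielsen (map swap w))"

definition nielsen_swap_inv :: "word \<Rightarrow> word" where
  "nielsen_swap_inv w = map swap (nielsen_inv (map swap w))"

lemma comp_in_hom: "f \<in> hom F2 F2 \<Longrightarrow> g \<in> hom F2 F2 \<Longrightarrow> f \<circ> g \<in> hom F2 F2"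
  using hom_compose by blast

lemma nielsen_hom [simp]:
  "nielsen \<in> hom F2 F2" "nielsen_inv \<in> hom F2 F2" "nielsen_swap \<in> hom F2 F2" "nielsen_swap_inv \<in> hom F2 F2"
proof -
  show 1: "nielsen \<in> hom F2 F2" by (rule nielsen_in_hom)
  have eq: "nielsen_inv = map flip \<circ> (nielsen \<circ> map flip)" "nielsen_swap = map swap \<circ> (nielsen \<circ> map swap)"
      "nielsen_swap_inv = map swap \<circ> (nielsen_inv \<circ> map swap)"
    by (simp_all add: fun_eq_iff nielsen_inv_def nielsen_swap_def nielsen_swap_inv_def)
  show 2: "nielsen_inv \<in> hom F2 F2"
    unfolding eq(1) by (intro comp_in_hom map_in_hom 1 letter_sym_flip)
  show "nielsen_swap \<in> hom F2 F2" "nielsen_swap_inv \<in> hom F2 F2"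
    unfolding eq(2,3) by (intro comp_in_hom map_in_hom 1 2 letter_sym_swap)+
qed

lemma hom_eq_on_basis:
  assumes "h \<in> hom F2 F2" "k \<in> hom F2 F2" "h [La] = k [La]" "h [Lb] = k [Lb]" "reduced w"
  shows "h w = k w"
  using F2_free_unique[OF group_F2 assms(1,2)] assms by (simp add: carrier_F2)

lemmas nielsen_eval = nielsen_def nielsen_inv_def nielsen_swap_def nielsen_swap_inv_def reduce_def

lemma nielsen_inverse:
  assumes "reduced w"
  shows "nielsen_inv (nielsen w) = w" "nielsen (nielsen_inv w) = w"
proof -
  have i: "(\<lambda>w. w) \<in> hom F2 F2" by (simp add: hom_def)
  have "(nielsen_inv \<circ> nielsen) w = (\<lambda>w. w) w"
    by (rule hom_eq_on_basis[where h = "nielsen_inv \<circ> nielsen", OF _ i _ _ assms]) (simp_all add: comp_in_hom, simp_all add: nielsen_eval)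
  then show "nielsen_inv (nielsen w) = w" by simp
  have "(nielsen \<circ> nielsen_inv) w = (\<lambda>w. w) w"
    by (rule hom_eq_on_basis[where h = "nielsen \<circ> nielsen_inv", OF _ i _ _ assms]) (simp_all add: comp_in_hom, simp_all add: nielsen_eval)
  then show "nielsen (nielsen_inv w) = w" by simp
qed

text \<open>Moving the substitution past a letter symmetry yields, up to conjugation, one of its four
  variants. A conjugation by \<open>b\<^sup>-\<^sup>1\<close> is needed where the symmetry inverts \<open>a\<close> or turns \<open>b\<close> into
  \<open>a\<^sup>-\<^sup>1\<close>, because then \<open>b\<close> is multiplied from the wrong side.\<close>

lemma nielsen_map_letter_sym:
  assumes "letter_sym s"
  obtains g where "g \<in> {nielsen, nielsen_inv, nielsen_swap, nielsen_swap_inv}"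
    "\<And>w. reduced w \<Longrightarrow> conjugate (map s (g w)) (nielsen (map s w))"
proof -
  have *: "conjugate (map s (g w)) (nielsen (map s w))"
    if g: "g \<in> {nielsen, nielsen_inv, nielsen_swap, nielsen_swap_inv}" and w: "reduced w"
      and c: "c = [] \<or> c = [Lb_inv]"
      "nielsen (map s [La]) = conj_by c (map s (g [La]))"
      "nielsen (map s [Lb]) = conj_by c (map s (g [Lb]))" for g c w
  proof -
    have "conjugate ((map s \<circ> g) w) ((nielsen \<circ> map s) w)"
    proof (rule homs_conjugate_on_basis[where g = c and h = "map s \<circ> g" and k = "nielsen \<circ> map s"])
      have "g \<in> hom F2 F2" using g by auto
      then show "map s \<circ> g \<in> hom F2 F2" "nielsen \<circ> map s \<in> hom F2 F2"
        using map_in_hom[OF assms] by (simp_all add: comp_in_hom)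
    qed (use w c in \<open>auto simp: reduced_Cons\<close>)
    then show ?thesis by simp
  qed
  from assms show ?thesis
  proof (cases rule: letter_sym_cases)
    case 1 show ?thesis by (rule that[OF _ *[of nielsen _ "[]"]]) (auto simp: 1 nielsen_eval conj_by_def mult_F2 reduced_Cons)
  next
    case 2 show ?thesis by (rule that[OF _ *[of nielsen_inv _ "[]"]]) (auto simp: 2 nielsen_eval conj_by_def mult_F2 reduced_Cons)
  next
    case 3 show ?thesis by (rule that[OF _ *[of nielsen_inv _ "[Lb_inv]"]]) (auto simp: 3 nielsen_eval conj_by_def mult_F2 reduced_Cons)
  next
    case 4 show ?thesis by (rule that[OF _ *[of nielsen _ "[Lb_inv]"]]) (auto simp: 4 nielsen_eval conj_by_def mult_F2 reduced_Cons)
  next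
    case 5 show ?thesis by (rule that[OF _ *[of nielsen_swap _ "[]"]]) (auto simp: 5 nielsen_eval conj_by_def mult_F2 reduced_Cons)
  next
    case 6 show ?thesis by (rule that[OF _ *[of nielsen_swap_inv _ "[Lb_inv]"]]) (auto simp: 6 nielsen_eval conj_by_def mult_F2 reduced_Cons)
  next
    case 7 show ?thesis by (rule that[OF _ *[of nielsen_swap_inv _ "[]"]]) (auto simp: 7 nielsen_eval conj_by_def mult_F2 reduced_Cons)
  next
    case 8 show ?thesis by (rule that[OF _ *[of nielsen_swap _ "[Lb_inv]"]]) (auto simp: 8 nielsen_eval conj_by_def mult_F2 reduced_Cons)
  qed
qed

text \<open>The relation that comes from the triangle \<open>{a, b, ab}\<close>: stepping from \<open>{a, b}\<close> to one of the
  two other edges and from there to the remaining one is, up to a letter symmetry, the direct step to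
  the remaining one.\<close>

lemma nielsen_inv_nielsen_swap:
  assumes "reduced w"
  shows "conjugate (nielsen_inv (nielsen_swap w)) (map (perm_of Lb_inv La) (nielsen w))"
proof -
  have s: "letter_sym (perm_of Lb_inv La)" by (rule letter_sym_perm_of) auto
  have "conjugate ((nielsen_inv \<circ> nielsen_swap) w) ((map (perm_of Lb_inv La) \<circ> nielsen) w)"
    by (rule homs_conjugate_on_basis[where g = "[Lb_inv]" and h = "nielsen_inv \<circ> nielsen_swap"
          and k = "map (perm_of Lb_inv La) \<circ> nielsen", OF _ _ _ _ _ assms])
      (simp_all add: comp_in_hom map_in_hom[OF s], simp_all add: nielsen_eval conj_by_def mult_F2 reduced_Cons)
  then show ?thesis by simp
qed

section \<open>Orbits as products of positive substitutions\<close>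

text \<open>Products of \<open>a \<mapsto> ab\<close> and \<open>b \<mapsto> ba\<close>. They describe the paths without backtracking that leave an edge
  through one fixed side.\<close>

inductive positive :: "word \<Rightarrow> word \<Rightarrow> bool" for w where
  base: "positive w w"
| nielsen: "positive w x \<Longrightarrow> positive w (nielsen x)"
| swap: "positive w x \<Longrightarrow> positive w (nielsen_swap x)"

lemma reduced_nielsen_swap [simp]: "reduced (nielsen_swap w)"
  by (simp add: nielsen_swap_def reduced_map)

lemma positive_reduced: "positive w x \<Longrightarrow> reduced w \<Longrightarrow> reduced x"
  by (induction rule: positive.induct) auto

lemma positive_swap: "positive w x \<Longrightarrow> positive (map swap w) (map swap x)"
proof (induction rule: positive.induct)
  case (nielsen x)
  have "map swap (nielsen x) = nielsen_swap (map swap x)" by (simp add: nielsen_swap_def del: map_map)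
  then show ?case using nielsen positive.swap by metis
next
  case (swap x)
  have "map swap (nielsen_swap x) = nielsen (map swap x)" by (simp add: nielsen_swap_def del: map_map)
  then show ?case using swap positive.nielsen by metis
qed (rule positive.base)

text \<open>The letter symmetry \<open>t\<close> chooses the side through which the path leaves, and \<open>s\<close> names the letters
  at its end.\<close>

definition orbit :: "word \<Rightarrow> word \<Rightarrow> bool" where
  "orbit w x \<longleftrightarrow> (\<exists>s t y. letter_sym s \<and> letter_sym t \<and> positive (map t w) y \<and> conjugate (map s y) x)"

lemma orbitI: "letter_sym s \<Longrightarrow> letter_sym t \<Longrightarrow> positive (map t w) y \<Longrightarrow> conjugate (map s y) x \<Longrightarrow> orbit w x"
  by (auto simp: orbit_def)

lemma orbit_conjugate: "orbit w x \<Longrightarrow> conjugate x y \<Longrightarrow> orbit w y"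
  unfolding orbit_def using conjugate_trans by blast

lemma orbit_map:
  assumes "orbit w x" "letter_sym r" shows "orbit w (map r x)"
proof -
  obtain s t y where "letter_sym s" "letter_sym t" "positive (map t w) y" "conjugate (map s y) x"
    using assms by (auto simp: orbit_def)
  then show ?thesis
    using orbitI[of "r \<circ> s" t w y] letter_sym_comp[OF assms(2)] conjugate_map[OF assms(2)] by fastforce
qed

lemma orbit_positive: "reduced w \<Longrightarrow> letter_sym t \<Longrightarrow> positive (map t w) y \<Longrightarrow> orbit w y"
  by (rule orbitI[of id t]) (auto simp: letter_sym_id positive_reduced reduced_map)

lemma orbit_refl: "reduced w \<Longrightarrow> orbit w w"
  using orbit_positive[of w id w] by (simp add: letter_sym_id positive.base)

text \<open>Extending the path by an inverse step. If the path is empty, this is a step through the other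
  side; if its last step was \<open>a \<mapsto> ab\<close>, this step is undone; if its last step was \<open>b \<mapsto> ba\<close>, the two
  steps cross the same triangle and merge into one.\<close>

lemma orbit_nielsen_inv:
  assumes "reduced w" "letter_sym t" "positive (map t w) y"
  shows "orbit w (nielsen_inv y)"
  using assms(3)
proof cases
  case base
  have ft: "letter_sym (flip \<circ> t)" by (simp add: letter_sym_comp assms(2))
  have "positive (map (flip \<circ> t) w) (nielsen (map (flip \<circ> t) w))"
    by (intro positive.intros)
  then have "orbit w (nielsen (map (flip \<circ> t) w))"
    using orbit_positive[OF assms(1) ft] by blast
  then show ?thesis using orbit_map[of w _ flip] base by (simp add: nielsen_inv_def)
next
  case (nielsen x)
  then have "nielsen_inv y = x" using nielsen_inverse positive_reduced assms by (simp add: reduced_map)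
  then show ?thesis using orbit_positive[OF assms(1,2)] nielsen by simp
next
  case (swap x)
  have x: "reduced x" using positive_reduced[OF swap(2)] assms by (simp add: reduced_map)
  have "orbit w (nielsen x)"
    using orbit_positive[OF assms(1,2)] swap(2) positive.nielsen by blast
  then have "orbit w (map (perm_of Lb_inv La) (nielsen x))"
    by (intro orbit_map letter_sym_perm_of) auto
  then show ?thesis
    using orbit_conjugate conjugate_sym nielsen_inv_nielsen_swap[OF x] swap(1) by blast
qed

lemma orbit_nielsen_swap_inv:
  assumes "reduced w" "letter_sym t" "positive (map t w) y"
  shows "orbit w (nielsen_swap_inv y)"
proof -
  have "positive (map (swap \<circ> t) w) (map swap y)" using positive_swap[OF assms(3)] by simp
  then have "orbit w (nielsen_inv (map swap y))"
    using orbit_nielsen_inv[OF assms(1), of "swap \<circ> t"] assms by (simp add: letter_sym_comp)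
  then show ?thesis unfolding nielsen_swap_inv_def by (intro orbit_map) auto
qed

lemma orbit_nielsen:
  assumes "reduced w" "orbit w x" shows "orbit w (nielsen x)"
proof -
  obtain s t y where st: "letter_sym s" "letter_sym t" "positive (map t w) y" "conjugate (map s y) x"
    using assms by (auto simp: orbit_def)
  have y: "reduced y" using positive_reduced st assms by (simp add: reduced_map)
  obtain g where g: "g \<in> {nielsen, nielsen_inv, nielsen_swap, nielsen_swap_inv}"
    "conjugate (map s (g y)) (nielsen (map s y))"
    using nielsen_map_letter_sym[OF st(1)] y by metis
  have "orbit w (g y)"
    using g(1) orbit_nielsen_inv[OF assms(1) st(2,3)] orbit_nielsen_swap_inv[OF assms(1) st(2,3)]
      orbit_positive[OF assms(1) st(2) positive.nielsen[OF st(3)]]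
      orbit_positive[OF assms(1) st(2) positive.swap[OF st(3)]]
    by (elim insertE) simp_all
  then have "orbit w (nielsen (map s y))"
    using g(2) orbit_conjugate orbit_map st(1) by blast
  moreover have "conjugate (nielsen (map s y)) (nielsen x)"
    using st(4) hom_conjugate by simp
  ultimately show ?thesis using orbit_conjugate by blast
qed

lemma orbit_nielsen_swap: "reduced w \<Longrightarrow> orbit w x \<Longrightarrow> orbit w (nielsen_swap x)"
  unfolding nielsen_swap_def by (intro orbit_map orbit_nielsen) auto

lemma orbit_trans:
  assumes "reduced w" "orbit w x" "orbit x y" shows "orbit w y"
proof -
  obtain s t z where st: "letter_sym s" "letter_sym t" "positive (map t x) z" "conjugate (map s z) y"
    using assms by (auto simp: orbit_def)
  from st(3) have "orbit w z"
    by (induction rule: positive.induct)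
      (simp_all add: orbit_map orbit_nielsen orbit_nielsen_swap assms(1,2) st(2))
  then show ?thesis using orbit_map st orbit_conjugate by blast
qed

section \<open>Adjacent letters of a cyclic word\<close>

definition cyc_pairs :: "word \<Rightarrow> (letter \<times> letter) list" where
  "cyc_pairs w = zip w (rotate1 w)"

definition cyc_count :: "letter \<Rightarrow> letter \<Rightarrow> word \<Rightarrow> int" where
  "cyc_count x y w = int (count_list (cyc_pairs w) (x, y))"

text \<open>The quantities \<open>A\<close>, \<open>B\<close> and \<open>d\<close> of the introduction.\<close>

definition num_aa :: "word \<Rightarrow> int" where
  "num_aa w = cyc_count La La w + cyc_count La_inv La_inv w"

definition num_bb :: "word \<Rightarrow> int" where
  "num_bb w = cyc_count Lb Lb w + cyc_count Lb_inv Lb_inv w"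

definition skew :: "word \<Rightarrow> int" where
  "skew w = cyc_count La Lb w + cyc_count Lb_inv La_inv w - cyc_count La Lb_inv w - cyc_count Lb La_inv w"

lemma length_cyc_pairs [simp]: "length (cyc_pairs w) = length w"
  by (simp add: cyc_pairs_def)

lemma cyc_pairs_Cons: "cyc_pairs (x # w) = zip (x # w) (w @ [x])"
  by (simp add: cyc_pairs_def)

lemma cyc_pairs_closed: "w \<noteq> [] \<Longrightarrow> cyc_pairs w = zip (w @ [hd w]) (tl (w @ [hd w]))"
  by (cases w) (simp_all add: cyc_pairs_def zip_append1 del: zip_Cons_Cons append_Cons flip: append_Cons)

lemma reduced_iff_pairs: "reduced w \<longleftrightarrow> (\<forall>(x, y)\<in>set (zip w (tl w)). y \<noteq> linv x)"
proof (induction w)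
  case (Cons x w)
  then show ?case by (cases w) (auto simp: reduced_Cons)
qed simp

lemma C2_iff_pairs: "w \<in> C2 \<longleftrightarrow> (\<forall>(x, y)\<in>set (cyc_pairs w). y \<noteq> linv x)"
proof (cases "w = []")
  case False
  then have "w \<in> C2 \<longleftrightarrow> reduced (w @ [hd w])"
    by (auto simp: C2_def carrier_F2 reduced_append reduced_Cons linv_eq_iff)
  then show ?thesis unfolding cyc_pairs_closed[OF False] reduced_iff_pairs .
qed (simp add: C2_def carrier_F2 cyc_pairs_def)

lemma cyc_pairs_rotate: "cyc_pairs (rotate n w) = rotate n (cyc_pairs w)"
proof -
  have "cyc_pairs (rotate1 w) = rotate1 (cyc_pairs w)" for w
  proof (cases w)
    case (Cons x u)
    show ?thesis
    proof (cases u)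
      case u: (Cons y v)
      show ?thesis using zip_append[of "y # v" "v @ [x]" "[x]" "[y]"] Cons u by (simp add: cyc_pairs_def)
    qed (simp add: Cons cyc_pairs_def)
  qed (simp add: cyc_pairs_def)
  then show ?thesis by (induction n) simp_all
qed

lemma count_list_rotate [simp]: "count_list (rotate n xs) x = count_list xs x"
proof -
  have "count_list (rotate1 xs) x = count_list xs x" for xs by (cases xs) auto
  then show ?thesis by (induction n) simp_all
qed

lemma cyc_count_rotate [simp]: "cyc_count x y (rotate n w) = cyc_count x y w"
  by (simp add: cyc_count_def cyc_pairs_rotate)

lemma rotate_C2 [simp]: "rotate n w \<in> C2 \<longleftrightarrow> w \<in> C2"
  by (simp add: C2_iff_pairs cyc_pairs_rotate)

lemma cyc_pairs_double: "cyc_pairs (x # x # w) = (x, x) # cyc_pairs (x # w)"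
  by (simp add: cyc_pairs_Cons)

lemma cyc_count_map: "letter_sym s \<Longrightarrow> cyc_count (s x) (s y) (map s w) = cyc_count x y w"
proof -
  assume s: "letter_sym s"
  have "cyc_pairs (map s w) = map (map_prod s s) (cyc_pairs w)"
    by (simp add: cyc_pairs_def zip_map_map rotate1_map map_prod_def)
  moreover have "inj (map_prod s s)" using letter_sym_inj[OF s] by (simp add: prod.inj_map)
  then have "count_list (map (map_prod s s) zs) (map_prod s s z) = count_list zs z" for zs z
    by (induction zs) (simp_all add: inj_eq)
  from this[of "cyc_pairs w" "(x, y)"] show ?thesis using calculation by (simp add: cyc_count_def)
qed

lemma cyc_count_linv: "w \<in> C2 \<Longrightarrow> cyc_count x (linv x) w = 0"
  by (auto simp: cyc_count_def count_list_0_iff C2_iff_pairs)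

text \<open>Both sides count the occurrences of \<open>x\<close>: every letter of a cyclic word has one successor and one
  predecessor.\<close>

lemma cyc_count_flow: "(\<Sum>y\<in>UNIV. cyc_count x y w) = (\<Sum>y\<in>UNIV. cyc_count y x w)"
proof -
  have f: "(\<Sum>y\<in>UNIV. int (count_list zs (x, y))) = int (count_list (map fst zs) x)" for zs :: "(letter \<times> letter) list"
  proof (induction zs)
    case (Cons p zs)
    have "int (count_list (p # zs) (x, y)) = (if snd p = y then of_bool (fst p = x) else 0) + int (count_list zs (x, y))" for y
      by (cases p) auto
    then show ?case using Cons by (simp add: sum.distrib)
  qed simp
  have s: "(\<Sum>y\<in>UNIV. int (count_list zs (y, x))) = int (count_list (map snd zs) x)" for zs :: "(letter \<times> letter) list"
  proof (induction zs)
    case (Cons p zs)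
    have "int (count_list (p # zs) (y, x)) = (if fst p = y then of_bool (snd p = x) else 0) + int (count_list zs (y, x))" for y
      by (cases p) auto
    then show ?case using Cons by (simp add: sum.distrib)
  qed simp
  show ?thesis using count_list_rotate[of 1 w x]
    unfolding cyc_count_def f s by (simp add: cyc_pairs_def)
qed

text \<open>The flow equations imply that \<open>ab\<close> and \<open>ba\<close> are equally frequent, and likewise \<open>ab\<^sup>-\<^sup>1\<close> and
  \<open>a\<^sup>-\<^sup>1b\<close>, when a pair is counted together with its inverse. This makes \<open>skew\<close> symmetric
  in \<open>a\<close> and \<open>b\<close>.\<close>

lemma cyc_count_balance:
  assumes "w \<in> C2"
  shows "cyc_count La Lb w + cyc_count Lb_inv La_inv w = cyc_count Lb La w + cyc_count La_inv Lb_inv w"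
    and "cyc_count La Lb_inv w + cyc_count Lb La_inv w = cyc_count La_inv Lb w + cyc_count Lb_inv La w"
  using cyc_count_flow[of La w] cyc_count_flow[of Lb w] cyc_count_flow[of La_inv w] cyc_count_flow[of Lb_inv w]
    cyc_count_linv[OF assms, of La] cyc_count_linv[OF assms, of Lb]
    cyc_count_linv[OF assms, of La_inv] cyc_count_linv[OF assms, of Lb_inv]
  by (simp_all add: UNIV_letter)

text \<open>Letter symmetries act on the counts like the symmetries of the edge \<open>{a, b}\<close>: they may exchange
  \<open>A\<close> with \<open>B\<close>, and they may change the sign of \<open>d\<close>.\<close>

lemma skew_map:
  assumes "letter_sym s" "w \<in> C2"
  shows "(skew (map s w) = skew w \<or> skew (map s w) = - skew w) \<and>
    (num_aa (map s w) = num_aa w \<and> num_bb (map s w) = num_bb w \<or>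
     num_aa (map s w) = num_bb w \<and> num_bb (map s w) = num_aa w)"
    and "skew (map flip w) = - skew w" "num_aa (map flip w) = num_aa w"
    "skew (map swap w) = skew w" "num_aa (map swap w) = num_bb w" "num_bb (map swap w) = num_aa w"
proof -
  have c: "cyc_count x y (map s w) = cyc_count (t x) (t y) w" if "\<And>z. s (t z) = z" "letter_sym s" for s t x y
    using cyc_count_map[OF that(2), of "t x" "t y" w] that(1) by simp
  have i: "perm_of p q (perm_of p q z) = z"
    if "(p, q) \<in> {(La, Lb), (La, Lb_inv), (La_inv, Lb), (La_inv, Lb_inv), (Lb, La), (Lb_inv, La_inv)}" for p q z
    using that by (cases z) auto
  have j: "perm_of Lb La_inv (perm_of Lb_inv La z) = z" "perm_of Lb_inv La (perm_of Lb La_inv z) = z" for z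
    by (cases z; simp)+
  note [simp] = skew_def num_aa_def num_bb_def
  note b = cyc_count_balance[OF assms(2)]
  show "skew (map flip w) = - skew w" "num_aa (map flip w) = num_aa w"
    using c[of flip flip] i[of La Lb_inv] by simp_all
  show "skew (map swap w) = skew w" "num_aa (map swap w) = num_bb w" "num_bb (map swap w) = num_aa w"
    using c[of swap swap] i[of Lb La] b by simp_all
  show "(skew (map s w) = skew w \<or> skew (map s w) = - skew w) \<and>
    (num_aa (map s w) = num_aa w \<and> num_bb (map s w) = num_bb w \<or>
     num_aa (map s w) = num_bb w \<and> num_bb (map s w) = num_aa w)"
    using assms(1)
  proof (cases rule: letter_sym_cases)
    case 1 then show ?thesis using b c[of s s] i[of La Lb] assms(1) by simp
  next
    case 2 then show ?thesis using b c[of s s] i[of La Lb_inv] assms(1) by simp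
  next
    case 3 then show ?thesis using b c[of s s] i[of La_inv Lb] assms(1) by simp
  next
    case 4 then show ?thesis using b c[of s s] i[of La_inv Lb_inv] assms(1) by simp
  next
    case 5 then show ?thesis using b c[of s s] i[of Lb La] assms(1) by simp
  next
    case 6 then show ?thesis using b c[of s "perm_of Lb_inv La"] j assms(1) by simp
  next
    case 7 then show ?thesis using b c[of s "perm_of Lb La_inv"] j assms(1) by simp
  next
    case 8 then show ?thesis using b c[of s s] i[of Lb_inv La_inv] assms(1) by simp
  qed
qed

section \<open>The substitution on cyclic words\<close>

text \<open>The image of a letter \<open>x\<close> is \<open>in_part x @ out_part x\<close>. Cutting the images in this way assigns every
  letter of the image of a cyclic word to the gap between two neighbouring letters, and all
  cancellation then happens inside the gaps.\<close>

fun out_part :: "letter \<Rightarrow> word" where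
  "out_part La = [La, Lb]" | "out_part Lb = [Lb]" | "out_part La_inv = []" | "out_part Lb_inv = []"

fun in_part :: "letter \<Rightarrow> word" where
  "in_part La = []" | "in_part Lb = []" | "in_part La_inv = [Lb_inv, La_inv]" | "in_part Lb_inv = [Lb_inv]"

definition gap :: "letter \<times> letter \<Rightarrow> word" where
  "gap p = reduce (out_part (fst p) @ in_part (snd p))"

definition cyc_nielsen :: "word \<Rightarrow> word" where
  "cyc_nielsen w = concat (map gap (cyc_pairs w))"

lemma gap_simps:
  "gap (La, La) = [La, Lb]" "gap (La, Lb) = [La, Lb]" "gap (La, Lb_inv) = [La]"
  "gap (Lb, La) = [Lb]" "gap (Lb, Lb) = [Lb]" "gap (Lb, La_inv) = [La_inv]"
  "gap (La_inv, La_inv) = [Lb_inv, La_inv]" "gap (La_inv, Lb) = []" "gap (La_inv, Lb_inv) = [Lb_inv]"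
  "gap (Lb_inv, La_inv) = [Lb_inv, La_inv]" "gap (Lb_inv, La) = []" "gap (Lb_inv, Lb_inv) = [Lb_inv]"
  by (simp_all add: gap_def reduce_def)

text \<open>The letters with which the image can begin, from the gap after a given letter onwards. Since some
  gaps are empty, the first letter may come from a later gap.\<close>

fun starts :: "letter \<Rightarrow> letter set" where
  "starts La = {La}" | "starts Lb = {Lb, La_inv}"
| "starts La_inv = {Lb_inv, Lb, La_inv}" | "starts Lb_inv = {Lb_inv, La}"

lemma reduced_gaps:
  assumes "reduced w" "w \<noteq> []" "c = concat (map gap (zip w (tl w)))"
  shows "reduced c \<and> (c \<noteq> [] \<longrightarrow> hd c \<in> starts (hd w))"
  using assms
proof (induction w arbitrary: c)
  case (Cons x w)
  show ?case
  proof (cases w)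
    case Nil
    then show ?thesis using Cons by simp
  next
    case w: (Cons y zs)
    define d where "d = concat (map gap (zip w (tl w)))"
    have d: "reduced d" "d \<noteq> [] \<longrightarrow> hd d \<in> starts y"
      using Cons.IH[OF _ _ d_def] Cons.prems w by (auto simp: reduced_Cons)
    have "c = gap (x, y) @ d" "y \<noteq> linv x"
      using Cons.prems w by (auto simp: d_def reduced_Cons)
    then show ?thesis using d
      by (cases x; cases y) (auto simp: gap_simps reduced_append reduced_Cons)
  qed
qed simp

text \<open>Going around the cyclic word twice turns cyclic reducedness into the linear statement
  \<open>reduced_gaps\<close>.\<close>

lemma cyc_nielsen_C2:
  assumes "w \<in> C2" shows "cyc_nielsen w \<in> C2"
proof (cases w)
  case (Cons x u)
  have "reduced (w @ w @ [x])"
  proof -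
    have "w \<noteq> []" "hd w = x" using Cons by auto
    then show ?thesis
      using assms reduced_append[of w w] reduced_append[of "w @ w" "[x]"]
      by (simp add: C2_iff_reduced_square reduced_Cons)
  qed
  then have "reduced (concat (map gap (zip (w @ w @ [x]) (tl (w @ w @ [x])))))"
    using reduced_gaps Cons by blast
  moreover have "zip (w @ w @ [x]) (tl (w @ w @ [x])) = cyc_pairs w @ cyc_pairs w"
  proof -
    have "zip (w @ w @ [x]) ((u @ [x]) @ (u @ [x])) = zip w (u @ [x]) @ zip (w @ [x]) (u @ [x])"
      using Cons by (subst zip_append) auto
    then show ?thesis using cyc_pairs_closed[of w] Cons by (simp add: cyc_pairs_Cons del: zip_Cons_Cons)
  qed
  ultimately show ?thesis by (simp add: C2_iff_reduced_square cyc_nielsen_def)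
qed (simp add: cyc_nielsen_def cyc_pairs_def C2_def carrier_F2)

lemma reduce_concat_map: "reduce (concat (map (\<lambda>p. reduce (f p)) zs)) = reduce (concat (map f zs))"
  by (induction zs) (simp_all add: reduce_append reduce_reduced reduced_reduce)

text \<open>Regrouping by gaps moves the first \<open>in_part\<close> from the beginning of the image to its end, which is
  a conjugation.\<close>

lemma conjugate_cyc_nielsen:
  assumes "w \<in> C2" shows "conjugate (cyc_nielsen w) (nielsen w)"
proof (cases w)
  case Nil
  then show ?thesis by (simp add: cyc_nielsen_def nielsen_def cyc_pairs_def reduce_def)
next
  case (Cons x u)
  have nielsen_letter_eq: "nielsen_letter y = in_part y @ out_part y" for y by (cases y) auto
  have "concat (map nielsen_letter (y # v)) @ in_part z =
      in_part y @ concat (map (\<lambda>p. out_part (fst p) @ in_part (snd p)) (zip (y # v) (v @ [z])))" for y v z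
    by (induction v arbitrary: y) (simp_all add: nielsen_letter_eq)
  then have "reduce (concat (map nielsen_letter w) @ in_part x) =
      reduce (in_part x @ concat (map (\<lambda>p. out_part (fst p) @ in_part (snd p)) (cyc_pairs w)))"
    using Cons by (simp only: cyc_pairs_Cons)
  moreover have "reduce (concat (map (\<lambda>p. out_part (fst p) @ in_part (snd p)) (cyc_pairs w))) = cyc_nielsen w"
    using reduce_concat_map[of "\<lambda>p. out_part (fst p) @ in_part (snd p)" "cyc_pairs w"]
      reduce_reduced[OF C2_reduced[OF cyc_nielsen_C2[OF assms]]]
    by (simp add: cyc_nielsen_def gap_def[abs_def])
  moreover have t: "reduced (in_part x)" by (cases x) (simp_all add: reduced_Cons)
  ultimately have "nielsen w \<cdot> in_part x = in_part x \<cdot> cyc_nielsen w"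
    by (simp add: reduce_append nielsen_def reduce_reduced)
  then have "nielsen w \<cdot> in_part x \<cdot> winv (in_part x) = conj_by (in_part x) (cyc_nielsen w)"
    by (simp add: conj_by_def)
  then have "nielsen w = conj_by (in_part x) (cyc_nielsen w)"
    using t by (simp add: mul_assoc)
  then show ?thesis
    using conjugateI[OF t C2_reduced[OF cyc_nielsen_C2[OF assms]]] t by simp
qed

text \<open>A gap has length two at \<open>aa\<close> and \<open>ab\<close>, length zero at \<open>a\<^sup>-\<^sup>1b\<close>, where pairs and their
  inverses behave alike, and length one elsewhere.\<close>

lemma length_cyc_nielsen:
  assumes "w \<in> C2"
  shows "int (length (cyc_nielsen w)) = int (length w) + num_aa w + skew w"
proof -
  define c where "c zs x y = int (count_list zs (x, y))" for zs :: "(letter \<times> letter) list" and x y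
  have "int (length (concat (map gap zs))) =
     int (length zs) + c zs La La + c zs La_inv La_inv + c zs La Lb + c zs Lb_inv La_inv
     - c zs La_inv Lb - c zs Lb_inv La"
    if "\<forall>(x, y)\<in>set zs. y \<noteq> linv x" for zs
    using that
  proof (induction zs)
    case (Cons p zs)
    obtain x y where p: "p = (x, y)" by fastforce
    have IH: "int (length (concat (map gap zs))) =
     int (length zs) + c zs La La + c zs La_inv La_inv + c zs La Lb + c zs Lb_inv La_inv
     - c zs La_inv Lb - c zs Lb_inv La" using Cons by simp
    have "y \<noteq> linv x" using Cons.prems p by simp
    then have "int (length (gap (x, y))) = 1 + c [p] La La + c [p] La_inv La_inv + c [p] La Lb + c [p] Lb_inv La_inv
     - c [p] La_inv Lb - c [p] Lb_inv La"
      unfolding p by (cases x; cases y) (simp_all add: gap_simps c_def)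
    moreover have "c (p # zs) u v = c [p] u v + c zs u v" for u v by (simp add: c_def)
    ultimately show ?case using IH p by simp
  qed (simp add: c_def)
  from this[of "cyc_pairs w"] show ?thesis
    using assms cyc_count_balance[OF assms]
    by (simp add: C2_iff_pairs cyc_nielsen_def c_def num_aa_def skew_def cyc_count_def)
qed

lemma cyclen_nielsen:
  assumes "w \<in> C2" shows "int (cyclen (nielsen w)) = int (length w) + num_aa w + skew w"
  using length_cyc_nielsen[OF assms] cyclen_conjugate[OF conjugate_cyc_nielsen[OF assms]]
    cyclen_C2[OF cyc_nielsen_C2[OF assms]] by simp

section \<open>Convexity of the cyclic length\<close>

definition gain :: "word \<Rightarrow> int" where
  "gain w = int (cyclen (nielsen w)) - int (cyclen w)"

lemma gain_conjugate: "conjugate u v \<Longrightarrow> gain u = gain v"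
  using cyclen_conjugate hom_conjugate[OF nielsen_in_hom] by (metis gain_def)

text \<open>The four steps from the edge \<open>{a, b}\<close>: the substitution after the identity, after the inversion of
  \<open>b\<close>, after the exchange of \<open>a\<close> and \<open>b\<close>, and after both.\<close>

lemma gain_C2:
  assumes "w \<in> C2"
  shows "gain w = num_aa w + skew w" "gain (map flip w) = num_aa w - skew w"
    "gain (map swap w) = num_bb w + skew w" "gain (map flip (map swap w)) = num_bb w - skew w"
proof -
  have *: "gain w = num_aa w + skew w" if "w \<in> C2" for w
    using that by (simp add: gain_def cyclen_nielsen cyclen_C2)
  have s: "map swap w \<in> C2" using assms by (simp add: map_C2)
  have f: "map flip u \<in> C2" if "u \<in> C2" for u using that by (simp add: map_C2)
  show "gain w = num_aa w + skew w" "gain (map flip w) = num_aa w - skew w"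
    "gain (map swap w) = num_bb w + skew w" "gain (map flip (map swap w)) = num_bb w - skew w"
    using *[OF assms] *[OF s] *[OF f[OF assms]] *[OF f[OF s]]
      skew_map(2-)[OF letter_sym_id assms] skew_map(2-)[OF letter_sym_id s] by (simp_all del: map_map)
qed

lemma num_nonneg: "num_aa w \<ge> 0" "num_bb w \<ge> 0"
  by (simp_all add: num_aa_def num_bb_def cyc_count_def)

text \<open>The first equation is the step back. The second one is the step to the third edge of the triangle
  just crossed, whose length is known from the starting edge.\<close>

lemma gain_inverse:
  assumes "reduced w"
  shows "gain (map flip (nielsen w)) = - gain w"
    "gain (map flip (map swap (nielsen w))) = gain (map swap w) - gain w"
proof -
  have sw: "reduced (map swap w)" using assms by (simp add: reduced_map)
  have fl: "cyclen (map flip (nielsen v)) = cyclen (nielsen v)" "cyclen (map swap (nielsen v)) = cyclen (nielsen v)" for v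
    by (simp_all add: cyclen_map)
  have r: "cyclen (map flip v) = cyclen v" if "reduced v" for v
    using that by (simp add: cyclen_map)
  have ni: "cyclen (nielsen (map flip v)) = cyclen (nielsen_inv v)" for v
    unfolding nielsen_inv_def by (simp add: cyclen_map)
  have "cyclen (nielsen (map flip (nielsen w))) = cyclen w"
    unfolding ni by (simp add: nielsen_inverse assms)
  then show "gain (map flip (nielsen w)) = - gain w" by (simp add: gain_def fl)
  have "map swap (nielsen w) = nielsen_swap (map swap w)"
    by (simp add: nielsen_swap_def del: map_map)
  then have "cyclen (nielsen (map flip (map swap (nielsen w)))) = cyclen (nielsen_inv (nielsen_swap (map swap w)))"
    unfolding ni by simp
  also have "\<dots> = cyclen (map (perm_of Lb_inv La) (nielsen (map swap w)))"
    by (rule cyclen_conjugate[OF nielsen_inv_nielsen_swap[OF sw]])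
  also have "\<dots> = cyclen (nielsen (map swap w))"
    by (intro cyclen_map letter_sym_perm_of) simp_all
  finally show "gain (map flip (map swap (nielsen w))) = gain (map swap w) - gain w"
    using assms by (simp add: gain_def fl r cyclen_map reduced_map del: map_map)
qed

text \<open>Neither of the two steps through the positive side shortens the word.\<close>

definition ascending :: "word \<Rightarrow> bool" where
  "ascending w \<longleftrightarrow> gain w \<ge> 0 \<and> gain (map swap w) \<ge> 0"

lemma ascending_swap: "ascending (map swap w) \<longleftrightarrow> ascending w"
  by (auto simp: ascending_def simp del: map_map)

lemma gain_representative:
  assumes "reduced w"
  obtains u where "u \<in> C2" "conjugate w u" "gain w = num_aa u + skew u" "gain (map flip w) = num_aa u - skew u"
    "gain (map swap w) = num_bb u + skew u" "gain (map flip (map swap w)) = num_bb u - skew u"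
proof -
  obtain u where u: "u \<in> C2" "conjugate w u" using C2_representative assms by blast
  have "gain (map flip w) = gain (map flip u)" "gain (map swap w) = gain (map swap u)"
    "gain (map flip (map swap w)) = gain (map flip (map swap u))" "gain w = gain u"
    using u by (simp_all add: gain_conjugate conjugate_map del: map_map)
  then show ?thesis using that u gain_C2[OF u(1)] by metis
qed

text \<open>Convexity. The step back has gain \<open>A - d \<le> 0\<close>, so \<open>d \<ge> A \<ge> 0\<close>, and the steps onward have the
  nonnegative gains \<open>A + d\<close> and \<open>B + d\<close>.\<close>

lemma ascending_nielsen:
  assumes "reduced w" "ascending w" shows "ascending (nielsen w)"
proof -
  obtain u where "gain (nielsen w) = num_aa u + skew u" "gain (map flip (nielsen w)) = num_aa u - skew u"
    "gain (map swap (nielsen w)) = num_bb u + skew u"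
    using gain_representative[of "nielsen w"] by auto
  then show ?thesis
    using gain_inverse(1)[OF assms(1)] num_nonneg[of u] assms(2) by (auto simp: ascending_def)
qed

lemma ascending_positive:
  assumes "reduced w" "ascending w" "positive w x"
  shows "ascending x" "cyclen w \<le> cyclen x"
proof -
  have "ascending x \<and> cyclen w \<le> cyclen x"
    using assms(3)
  proof (induction rule: positive.induct)
    case (nielsen x)
    then show ?case
      using ascending_nielsen[OF positive_reduced[OF nielsen(1) assms(1)]] by (auto simp: ascending_def gain_def)
  next
    case (swap x)
    have r: "reduced (map swap x)" using positive_reduced[OF swap(1) assms(1)] by (simp add: reduced_map)
    have a: "ascending (map swap x)" using swap ascending_swap by blast
    have "cyclen (map swap x) \<le> cyclen (nielsen (map swap x))"
      using a by (simp add: ascending_def gain_def)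
    then have "cyclen x \<le> cyclen (nielsen_swap x)"
      using positive_reduced[OF swap(1) assms(1)] by (simp add: nielsen_swap_def cyclen_map)
    moreover have "ascending (nielsen_swap x)"
      unfolding nielsen_swap_def ascending_swap by (rule ascending_nielsen[OF r a])
    ultimately show ?case using swap by simp
  qed (use assms in auto)
  then show "ascending x" "cyclen w \<le> cyclen x" by auto
qed

text \<open>The word has the same length on all three edges of one of the two triangles through \<open>{a, b}\<close>.\<close>

definition triangular :: "word \<Rightarrow> bool" where
  "triangular w \<longleftrightarrow> gain w = 0 \<and> gain (map swap w) = 0 \<or>
     gain (map flip w) = 0 \<and> gain (map flip (map swap w)) = 0"

lemma triangular_C2:
  assumes "u \<in> C2"
  shows "triangular u \<longleftrightarrow> num_aa u = \<bar>skew u\<bar> \<and> num_bb u = \<bar>skew u\<bar>"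
proof -
  have "triangular u \<longleftrightarrow> num_aa u = - skew u \<and> num_bb u = - skew u \<or> num_aa u = skew u \<and> num_bb u = skew u"
    unfolding triangular_def gain_C2[OF assms] by (simp add: eq_neg_iff_add_eq_0)
  then show ?thesis using num_nonneg[of u] by (cases "skew u \<ge> 0") auto
qed

lemma triangular_conjugate: "conjugate v w \<Longrightarrow> triangular v = triangular w"
proof -
  assume "conjugate v w"
  then have "gain v = gain w" "gain (map flip v) = gain (map flip w)" "gain (map swap v) = gain (map swap w)"
    "gain (map flip (map swap v)) = gain (map flip (map swap w))"
    by (simp_all add: gain_conjugate conjugate_map del: map_map)
  then show ?thesis unfolding triangular_def by simp
qed

lemma triangular_map:
  assumes "letter_sym s" "reduced w" shows "triangular (map s w) \<longleftrightarrow> triangular w"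
proof -
  obtain u where u: "u \<in> C2" "conjugate w u" using C2_representative assms by blast
  have "map s u \<in> C2" "conjugate (map s w) (map s u)"
    using u assms by (simp_all add: map_C2 conjugate_map)
  then have "triangular (map s w) = triangular (map s u)" "triangular w = triangular u"
    using u triangular_conjugate by blast+
  moreover have "\<bar>skew (map s u)\<bar> = \<bar>skew u\<bar>"
    using skew_map(1)[OF assms(1) u(1)] by (metis abs_minus_cancel)
  ultimately show ?thesis
    unfolding triangular_C2[OF u(1)] triangular_C2[OF \<open>map s u \<in> C2\<close>]
    using skew_map(1)[OF assms(1) u(1)] by metis
qed

text \<open>If the word is triangular and one step through the positive side keeps the length, then so does the
  other: should the constant triangle lie on the negative side, then \<open>A = B = d\<close>, and
  \<open>A + d = 0\<close> forces \<open>A = B = d = 0\<close>. Hence the triangle that is being crossed is constant, and it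
  also contains the edge where the step ends.\<close>

lemma triangular_nielsen:
  assumes "reduced w" "triangular w" "gain w = 0" shows "triangular (nielsen w)"
proof -
  obtain u where "gain w = num_aa u + skew u" "gain (map flip w) = num_aa u - skew u"
    "gain (map swap w) = num_bb u + skew u" "gain (map flip (map swap w)) = num_bb u - skew u"
    using gain_representative[OF assms(1)] by metis
  then have "gain (map swap w) = 0"
    using assms(2,3) num_nonneg[of u] by (auto simp: triangular_def)
  then show ?thesis
    using gain_inverse[OF assms(1)] assms(3) by (simp add: triangular_def del: map_map)
qed

text \<open>By convexity the length is constant along the whole path, so \<open>triangular_nielsen\<close> applies to
  each step.\<close>

lemma triangular_positive:
  assumes "reduced w" "ascending w" "triangular w" "positive w x" "cyclen x \<le> cyclen w"
  shows "triangular x"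
  using assms(4,5)
proof (induction rule: positive.induct)
  case (nielsen x)
  have x: "reduced x" "ascending x" "cyclen w \<le> cyclen x"
    using positive_reduced ascending_positive nielsen assms by blast+
  then have "gain x = 0" "cyclen x \<le> cyclen w"
    using nielsen by (auto simp: ascending_def gain_def)
  then show ?case using triangular_nielsen x nielsen by blast
next
  case (swap x)
  have x: "reduced x" "ascending x" "cyclen w \<le> cyclen x"
    using positive_reduced ascending_positive swap assms by blast+
  have "cyclen (nielsen (map swap x)) \<le> cyclen w"
    using swap by (simp add: nielsen_swap_def cyclen_map)
  then have g: "gain (map swap x) = 0" "cyclen x \<le> cyclen w"
    using x by (auto simp: ascending_def gain_def cyclen_map)
  then have "triangular (map swap x)" using swap x by (simp add: triangular_map)
  then have "triangular (nielsen (map swap x))"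
    using triangular_nielsen g x by (simp add: reduced_map)
  then show ?case by (simp add: nielsen_swap_def triangular_map)
qed (use assms in auto)

text \<open>None of the four steps has negative gain.\<close>

definition locally_minimal :: "word \<Rightarrow> bool" where
  "locally_minimal w \<longleftrightarrow> \<bar>skew w\<bar> \<le> num_aa w \<and> \<bar>skew w\<bar> \<le> num_bb w"

lemma locally_minimal_map: "letter_sym s \<Longrightarrow> w \<in> C2 \<Longrightarrow> locally_minimal w \<Longrightarrow> locally_minimal (map s w)"
  using skew_map(1)[of s w] by (auto simp: locally_minimal_def)

lemma locally_minimal_ascending: "w \<in> C2 \<Longrightarrow> locally_minimal w \<Longrightarrow> ascending w"
  using gain_C2[of w] by (auto simp: locally_minimal_def ascending_def)

text \<open>A locally minimal word ascends through both sides, so it does not matter through which side the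
  path leaves.\<close>

lemma orbit_representative:
  assumes "w \<in> C2" "locally_minimal w" "orbit w v"
  obtains s t x where "letter_sym s" "letter_sym t" "positive (map t w) x" "conjugate (map s x) v"
    "ascending (map t w)" "reduced (map t w)" "reduced x" "cyclen x = cyclen v" "cyclen (map t w) = length w"
proof -
  obtain s t x where st: "letter_sym s" "letter_sym t" "positive (map t w) x" "conjugate (map s x) v"
    using assms by (auto simp: orbit_def)
  moreover have "reduced (map t w)" using st assms by (simp add: reduced_map C2_reduced)
  moreover have "ascending (map t w)"
    using st assms locally_minimal_ascending[of "map t w"] by (simp add: locally_minimal_map map_C2)
  moreover have x: "reduced x" using calculation positive_reduced by blast
  moreover have "cyclen x = cyclen v"
    using cyclen_conjugate[OF st(4)] cyclen_map[OF st(1) x] by simp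
  moreover have "cyclen (map t w) = length w"
    using st assms by (simp add: cyclen_map C2_reduced cyclen_C2)
  ultimately show ?thesis using that by blast
qed

lemma locally_minimal_orbit:
  assumes "w \<in> C2" "locally_minimal w" "orbit w v" shows "length w \<le> cyclen v"
  using orbit_representative[OF assms] ascending_positive by metis

lemma triangular_orbit:
  assumes "w \<in> C2" "locally_minimal w" "orbit w v" "triangular w" "cyclen v = length w"
  shows "triangular v"
proof -
  obtain s t x where x: "letter_sym s" "letter_sym t" "positive (map t w) x" "conjugate (map s x) v"
    "ascending (map t w)" "reduced (map t w)" "reduced x" "cyclen x = cyclen v" "cyclen (map t w) = length w"
    using orbit_representative[OF assms(1-3)] by metis
  have "triangular (map t w)" using x assms by (simp add: triangular_map C2_reduced)
  then have "triangular x" using triangular_positive x assms(5) by simp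
  then show ?thesis using triangular_conjugate[OF x(4)] x by (simp add: triangular_map)
qed

section \<open>Generation by Nielsen substitutions\<close>

lemma reduced_nth: "reduced w \<Longrightarrow> Suc i < length w \<Longrightarrow> w ! Suc i \<noteq> linv (w ! i)"
  unfolding reduced_def successively_conv_nth by blast

text \<open>If the cancelled part reached the middle of \<open>w\<close>, then the letter in the middle would be its own
  inverse, or the two letters in the middle would be inverse to each other.\<close>

lemma self_cancellation:
  assumes "reduced w" "w \<noteq> []" "w = u @ r" "w = winv r @ v"
  shows "2 * length r < length w"
proof (rule ccontr)
  define n k where "n = length w" and "k = length r"
  define j where "j = (n - 1) div 2"
  assume "\<not> ?thesis"
  then have nk: "n \<le> 2 * k" "0 < n" "k \<le> n" using assms by (auto simp: n_def k_def)
  then have j: "j < k" unfolding j_def by linarith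
  have "w ! j = winv r ! j" using assms(4) j by (simp add: nth_append k_def)
  also have "\<dots> = linv (r ! (k - 1 - j))" using j by (simp add: winv_def rev_nth k_def)
  also have "r ! (k - 1 - j) = w ! (n - 1 - j)"
  proof -
    have "n - 1 - j = length u + (k - 1 - j)" using assms(3) j by (simp add: n_def k_def)
    then show ?thesis using assms(3) by (simp add: nth_append)
  qed
  finally have *: "w ! j = linv (w ! (n - 1 - j))" .
  show False
  proof (cases "odd n")
    case True
    then obtain i where "n = 2 * i + 1" by (elim oddE)
    then have "n - 1 - j = j" by (simp add: j_def)
    then show False using * by simp
  next
    case False
    then obtain i where i: "n = 2 * i" by (auto elim: evenE)
    then have "j = i - 1" using nk by (simp add: j_def)
    then have e: "n - 1 - j = Suc j" "Suc j < n" using nk i by simp_all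
    have "w ! j = linv (w ! Suc j)" using * unfolding e(1) .
    then have "w ! Suc j = linv (w ! j)" by (metis linv_linv)
    then show False using e(2) reduced_nth[OF assms(1), of j] n_def by blast
  qed
qed

text \<open>The images of the letters under an automorphism whose total length cannot be reduced by replacing
  \<open>(x, y)\<close> with \<open>(xy, y)\<close> and conjugating. Nielsen's argument shows that in products of such words
  at least one letter of every factor survives. The conjugating element \<open>g\<close> takes the place of
  the well-ordering by which Nielsen reduction usually resolves ties.\<close>

locale short_basis =
  fixes f :: "letter \<Rightarrow> word"
  assumes red: "reduced (f l)" and linv: "f (linv l) = winv (f l)" and nonempty: "f l \<noteq> []"
    and short: "\<lbrakk>y \<noteq> x; y \<noteq> linv x; reduced g\<rbrakk> \<Longrightarrow>
      length (f x) + length (f y) \<le> length (conj_by g (f x \<cdot> f y)) + length (conj_by g (f y))"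
begin

text \<open>The number of letters of \<open>f x\<close>, and of \<open>f y\<close>, that cancel in the product.\<close>

definition overlap :: "letter \<Rightarrow> letter \<Rightarrow> nat" where
  "overlap x y = (length (f x) + length (f y) - length (f x \<cdot> f y)) div 2"

lemma overlapE:
  obtains u r v where "f x = u @ r" "f y = winv r @ v" "reduced (u @ v)" "f x \<cdot> f y = u @ v"
    "length r = overlap x y"
proof -
  obtain u r v where "f x = u @ r" "f y = winv r @ v" "reduced (u @ v)" "f x \<cdot> f y = u @ v"
    using cancellation[OF red[of x] red[of y]] by blast
  then show ?thesis using that by (simp add: overlap_def)
qed

lemma overlap_self: "2 * overlap x x < length (f x)"
proof -
  obtain u r v where "f x = u @ r" "f x = winv r @ v" "length r = overlap x x"
    using overlapE[of x x] by metis
  then show ?thesis using self_cancellation[OF red nonempty, of x u r v] by simp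
qed

lemma overlap_le:
  assumes "y \<noteq> linv x" shows "2 * overlap x y \<le> length (f x)" "2 * overlap x y \<le> length (f y)"
proof -
  have "2 * overlap x y \<le> length (f x) \<and> 2 * overlap x y \<le> length (f y)"
  proof (cases "y = x")
    case True
    then show ?thesis using overlap_self[of x] by simp
  next
    case False
    obtain u r v where d: "f x = u @ r" "f y = winv r @ v" "f x \<cdot> f y = u @ v" "length r = overlap x y"
      using overlapE[of x y] by metis
    have "length (f x) \<le> length (f x \<cdot> f y)"
      using short[OF False assms, of "[]"] red by simp
    moreover have "length (f y) \<le> length (f x \<cdot> f y)"
    proof -
      have "linv x \<noteq> linv y" "linv x \<noteq> linv (linv y)" using False assms by auto
      from short[OF this, of "[]"] show ?thesis
        using red by (simp add: linv flip: winv_mul_distrib)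
    qed
    ultimately show ?thesis using d by simp
  qed
  then show "2 * overlap x y \<le> length (f x)" "2 * overlap x y \<le> length (f y)" by auto
qed

text \<open>A factor \<open>f m\<close> is not consumed half from the left and half from the right. Otherwise, writing
  \<open>f m = r\<^sup>-\<^sup>1 s\<close>, the neighbours are both \<open>f l = s\<^sup>-\<^sup>1 q r\<close>, and so \<open>f m \<cdot> f l = r\<^sup>-\<^sup>1 q r\<close>.
  Conjugation by \<open>r\<close> turns the pair of \<open>f m \<cdot> f l\<close> and \<open>f m\<close> into \<open>q\<close> and \<open>s r\<^sup>-\<^sup>1\<close>, and their
  total length is at most \<open>\<bar>f l\<bar>\<close>.\<close>

lemma no_double_overlap:
  assumes "m \<noteq> linv l" "n \<noteq> linv m"
  shows "\<not> (2 * overlap l m = length (f m) \<and> 2 * overlap m n = length (f m))"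
proof
  assume h: "2 * overlap l m = length (f m) \<and> 2 * overlap m n = length (f m)"
  then have "l \<noteq> m" "n \<noteq> m" using overlap_self[of m] by auto
  then have n: "n = l \<or> n = linv l" and lm: "linv m \<noteq> linv l" "linv m \<noteq> linv (linv l)"
    using assms by (cases l; cases m; cases n; simp)+
  obtain u r y where d1: "f l = u @ r" "f m = winv r @ y" "length r = overlap l m"
    using overlapE[of l m] by metis
  obtain u2 s z where d2: "f m = u2 @ s" "f n = winv s @ z" "length s = overlap m n"
    using overlapE[of m n] by metis
  have "length y = length s" using d1 d2 h by simp
  then have s: "y = s" using d1(2) d2(1) by (metis append_eq_append_conv)
  have rs: "length r = length s" using d1 d2 h by simp
  have red_r: "reduced r" "reduced s" "reduced u"
    using red[of l] red[of m] d1 s by (auto simp: reduced_append)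
  from n show False
  proof
    assume "n = linv l"
    then have "winv s @ z = winv r @ winv u" using d1(1) d2(2) linv by simp
    then have "r = s" using rs by (metis append_eq_append_conv winv_simps(4,5))
    then have "f m = winv r \<cdot> r" using red[of m] d1(2) s mul_eq_append by metis
    then show False using nonempty red_r by simp
  next
    assume "n = l"
    then have "winv s @ z = u @ r" using d1 d2 by simp
    moreover have "length s \<le> length u" using overlap_le(1)[OF assms(1)] d1 rs by simp
    ultimately obtain q where u: "u = winv s @ q"
      by (metis append_eq_append_conv_if append_take_drop_id winv_simps(4))
    then have fl: "f l = winv s @ q @ r" using d1 by simp
    have rq: "reduced q" using red_r u by (simp add: reduced_append)
    have e1: "f l = winv s \<cdot> (q \<cdot> r)"
      using red[of l] unfolding fl by (metis mul_eq_append reduced_append)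
    have e2: "f m = winv r \<cdot> s"
      using red[of m] d1(2) s mul_eq_append by metis
    \<comment> \<open>the inverse pair, since \<open>short\<close> multiplies on the right: \<open>f (linv l) \<cdot> f (linv m)\<close> is the inverse of \<open>f m \<cdot> f l\<close>\<close>
    have "conj_by r (f (linv l) \<cdot> f (linv m)) = winv q"
      unfolding linv e1 e2 using red_r rq by (simp add: conj_by_def winv_mul_distrib mul_assoc)
    moreover have "length (conj_by r (f (linv m))) \<le> 2 * length r"
    proof -
      have "conj_by r (f (linv m)) = r \<cdot> winv s"
        unfolding linv e2 using red_r by (simp add: conj_by_def winv_mul_distrib mul_assoc)
      then show ?thesis using length_mul[of "winv s" r] red_r rs by simp
    qed
    ultimately have "length (f l) + length (f m) \<le> length q + 2 * length r"
      using short[OF lm red_r(1)] by (simp add: linv)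
    then show False using fl d1(2) s rs nonempty[of m] by auto
  qed
qed

definition product :: "word \<Rightarrow> word" where
  "product w = foldr (\<lambda>l z. f l \<cdot> z) w []"

lemma product_simps: "product [] = []" "product (l # w) = f l \<cdot> product w"
  by (simp_all add: product_def)

lemma reduced_product: "reduced (product w)"
  by (induction w) (simp_all add: product_simps red)

text \<open>The product begins with the part of its first factor that the second factor does not cancel. This
  part is longer than what a factor in front can cancel, so prepending a factor cancels only
  \<open>overlap\<close> letters and does not shorten the product.\<close>

lemma product_prefix:
  assumes "reduced (l # w)"
  shows "\<exists>p e t. f l = p @ e \<and> length e = (if w = [] then 0 else overlap l (hd w)) \<and>
    product (l # w) = p @ t \<and> (\<forall>m\<in>set (l # w). length (f m) \<le> length (product (l # w)))"
  using assms
proof (induction w arbitrary: l)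
  case Nil
  then show ?case using red by (simp add: product_simps)
next
  case (Cons m w)
  have lm: "m \<noteq> linv l" "reduced (m # w)" using Cons.prems by (auto simp: reduced_Cons)
  obtain p e t where IH: "f m = p @ e" "length e = (if w = [] then 0 else overlap m (hd w))"
    "product (m # w) = p @ t" "\<And>n. n \<in> set (m # w) \<Longrightarrow> length (f n) \<le> length (product (m # w))"
    using Cons.IH[OF lm(2)] by metis
  obtain u r v where d: "f l = u @ r" "f m = winv r @ v" "reduced (u @ v)" "length r = overlap l m"
    using overlapE[of l m] by metis
  have c: "2 * length r \<le> length (f l)" "2 * length r \<le> length (f m)"
    using overlap_le[OF lm(1)] d by auto
  have "length r < length p"
  proof (cases w)
    case Nil
    then have "p = f m" "0 < length (f m)" using IH(1,2) nonempty[of m] by simp_all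
    then show ?thesis using c(2) unfolding \<open>p = f m\<close> by linarith
  next
    case (Cons n w')
    then have n: "n \<noteq> linv m" using lm(2) by (simp add: reduced_Cons)
    have e: "length e = overlap m n" using IH(2) Cons by simp
    have "length (f m) = length p + length e" using IH(1) by simp
    moreover have "2 * length e \<le> length (f m)" using overlap_le(1)[OF n] e by simp
    moreover have "2 * length r \<noteq> length (f m) \<or> 2 * length e \<noteq> length (f m)"
      using no_double_overlap[OF lm(1) n] d(4) e by simp
    ultimately show ?thesis using c(2) by linarith
  qed
  then obtain y where y: "p = winv r @ y" "y \<noteq> []"
  proof -
    have "winv r @ v = p @ e" using d IH by simp
    then have "p = winv r @ drop (length r) p"
      using \<open>length r < length p\<close>
      by (metis append_eq_append_conv_if append_take_drop_id less_imp_le not_le winv_simps(4))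
    then show ?thesis using that \<open>length r < length p\<close> by (metis drop_eq_Nil not_le)
  qed
  have v: "v = y @ e" using d(2) IH(1) y by simp
  have yt: "reduced (winv r @ (y @ t))" using reduced_product[of "m # w"] IH(3) y by simp
  have r: "reduced u" "reduced r" "reduced (y @ t)"
    using yt red[of l] d by (auto simp: reduced_append)
  have uyt: "reduced (u @ (y @ t))"
    using d(3) r y(2) unfolding v by (auto simp: reduced_append)
  have "product (l # m # w) = f l \<cdot> product (m # w)" by (simp only: product_simps)
  also have "\<dots> = (u \<cdot> r) \<cdot> (winv r \<cdot> (y @ t))"
    using mul_eq_append[OF yt] mul_eq_append[of u r] red[of l] d(1) IH(3) y by simp
  also have "\<dots> = u @ (y @ t)"
    using r mul_eq_append[OF uyt] by (simp add: mul_assoc)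
  finally have pr: "product (l # m # w) = u @ y @ t" .
  have len: "length (f n) \<le> length (product (l # m # w))" if "n \<in> set (l # m # w)" for n
  proof (cases "n = l")
    case True
    have "length (f m) \<le> length (product (m # w))" using IH(4) by simp
    then show ?thesis using True pr IH(3) y d(1) c by simp
  next
    case False
    then have "length (f n) \<le> length (product (m # w))" using IH(4) that by simp
    then show ?thesis using pr IH(3) y d(1) c by simp
  qed
  show ?case
    by (rule exI[of _ u], rule exI[of _ r], rule exI[of _ "y @ t"]) (use d pr len in auto)
qed

lemma length_product: "reduced w \<Longrightarrow> m \<in> set w \<Longrightarrow> length (f m) \<le> length (product w)"
  using product_prefix[of "hd w" "tl w"] by (cases w) auto

end

lemma iso_F2I:
  assumes "h \<in> hom F2 F2" "k \<in> hom F2 F2"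
    "\<And>w. reduced w \<Longrightarrow> h (k w) = w" "\<And>w. reduced w \<Longrightarrow> k (h w) = w"
  shows "h \<in> iso F2 F2"
proof -
  have "bij_betw h {w. reduced w} {w. reduced w}"
    by (rule bij_betwI[of _ _ _ k]) (use assms hom_reduced in auto)
  then show ?thesis using assms(1) by (simp add: iso_def carrier_F2)
qed

lemma nielsen_iso: "nielsen \<in> iso F2 F2"
  using nielsen_inverse by (intro iso_F2I[of _ nielsen_inv]) simp_all

lemma letter_sym_inverse:
  assumes "letter_sym s" obtains t where "letter_sym t" "\<And>x. s (t x) = x" "\<And>x. t (s x) = x"
proof
  have b: "bij s" using assms by (simp add: letter_sym_def)
  show 1: "s (inv_into UNIV s x) = x" "inv_into UNIV s (s x) = x" for x
    using b by (simp_all add: bij_inv_eq_iff bij_is_inj surj_f_inv_f bij_is_surj)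
  have "inv_into UNIV s (linv x) = linv (inv_into UNIV s x)" for x
    using letter_sym_linv[OF assms, of "inv_into UNIV s x"] 1 by metis
  then show "letter_sym (inv_into UNIV s)" using b by (simp add: letter_sym_def bij_imp_bij_inv)
qed

lemma map_iso: "letter_sym s \<Longrightarrow> map s \<in> iso F2 F2"
proof -
  assume s: "letter_sym s"
  then obtain t where "letter_sym t" "\<And>x. s (t x) = x" "\<And>x. t (s x) = x" using letter_sym_inverse by blast
  then show ?thesis using s by (intro iso_F2I[of _ "map t"]) (simp_all add: map_in_hom map_idI comp_def)
qed

lemma conj_by_iso: "reduced g \<Longrightarrow> conj_by g \<in> iso F2 F2"
  by (rule iso_F2I[of _ "conj_by (winv g)"]) (simp_all add: conj_by_in_hom conj_by_mul)

text \<open>Nielsen reduction changes an automorphism on the side of its argument, whereas \<open>orbit\<close> is built up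
  on the side of its value; transitivity of \<open>orbit\<close> connects the two.\<close>

lemma orbit_precompose:
  assumes "letter_sym t" "reduced g" "\<phi> \<in> hom F2 F2" "reduced w"
    and IH: "\<And>v. reduced v \<Longrightarrow> orbit v (conj_by g (\<phi> (map t (nielsen v))))"
  shows "orbit w (\<phi> w)"
proof -
  obtain t' where t': "letter_sym t'" "\<And>x. t (t' x) = x" using letter_sym_inverse[OF assms(1)] by metis
  define v where "v = nielsen_inv (map t' w)"
  have v: "reduced v" using hom_reduced[of nielsen_inv] t' assms by (simp add: v_def reduced_map)
  have "map t (nielsen v) = w"
    using t' assms(4) by (simp add: v_def nielsen_inverse reduced_map comp_def)
  then have "orbit v (conj_by g (\<phi> w))" using IH[OF v] by simp
  moreover have "orbit w v"
    unfolding v_def nielsen_inv_def using assms t' by (intro orbit_map orbit_nielsen orbit_refl) simp_all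
  moreover have "conjugate (conj_by g (\<phi> w)) (\<phi> w)"
    using assms hom_reduced by (simp add: conjugate_sym conjugateI)
  ultimately show ?thesis using orbit_trans orbit_conjugate assms(4) by blast
qed

lemma iso_hom: "\<phi> \<in> iso F2 F2 \<Longrightarrow> \<phi> \<in> hom F2 F2"
  by (simp add: iso_def)

lemma iso_inj: "\<phi> \<in> iso F2 F2 \<Longrightarrow> reduced u \<Longrightarrow> reduced v \<Longrightarrow> \<phi> u = \<phi> v \<longleftrightarrow> u = v"
  by (auto simp: iso_def carrier_F2 bij_betw_def inj_on_eq_iff)

lemma comp_in_iso: "f \<in> iso F2 F2 \<Longrightarrow> g \<in> iso F2 F2 \<Longrightarrow> f \<circ> g \<in> iso F2 F2"
  using iso_set_trans by blast

lemma Cons_eq_mul: "reduced (l # w) \<Longrightarrow> l # w = [l] \<cdot> w"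
  using mul_eq_append[of "[l]" w] by simp

text \<open>The preimages of the basis are words in letters \<open>m\<close> with \<open>\<bar>\<phi> [m]\<bar> \<le> 1\<close>, because products are at
  least as long as their factors. If \<open>x\<close> were not such a letter, then no preimage at all could
  contain \<open>x\<close>, but \<open>[x]\<close> is itself a preimage.\<close>

lemma short_iso_letters:
  assumes "\<phi> \<in> iso F2 F2" "short_basis (\<lambda>l. \<phi> [l])"
  shows "length (\<phi> [x]) = 1"
proof (rule ccontr)
  assume x: "length (\<phi> [x]) \<noteq> 1"
  interpret short_basis "\<lambda>l. \<phi> [l]" by fact
  have r: "reduced [l]" for l by (simp add: reduced_Cons)
  have hom: "\<phi> \<in> hom F2 F2" using assms iso_hom by blast
  have product: "product w = \<phi> w" if "reduced w" for w
    using that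
  proof (induction w)
    case (Cons l w)
    have w: "reduced w" using Cons.prems by (simp add: reduced_Cons)
    have "product (l # w) = \<phi> [l] \<cdot> \<phi> w" using Cons.IH[OF w] by (simp only: product_simps)
    also have "\<dots> = \<phi> (l # w)"
      using Cons_eq_mul[OF Cons.prems] hom_mul[OF hom r w] by metis
    finally show ?case .
  qed (simp add: product_simps hom_Nil[OF hom])
  define \<psi> where "\<psi> = inv_into {w. reduced w} \<phi>"
  have psi: "\<psi> \<in> iso F2 F2" using F2.iso_set_sym[OF assms(1)] by (simp add: \<psi>_def carrier_F2)
  then have psi_hom: "\<psi> \<in> hom F2 F2" by (rule iso_hom)
  have phi_psi: "\<phi> (\<psi> w) = w" and psi_phi: "\<psi> (\<phi> w) = w" if "reduced w" for w
    using assms(1) that unfolding \<psi>_def iso_def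
    by (auto simp: carrier_F2 bij_betw_inv_into_left bij_betw_inv_into_right)
  \<comment> \<open>\<open>x\<close> and its inverse do not occur\<close>
  define free where "free w \<longleftrightarrow> x \<notin> set w \<and> linv x \<notin> set w" for w
  have free_letter: "free (\<psi> [l])" for l
  proof -
    have "length (\<phi> [m]) \<le> 1" if "m \<in> set (\<psi> [l])" for m
      using length_product[OF _ that] product phi_psi[OF r] hom_reduced[OF psi_hom r] by simp
    moreover have "length (\<phi> [x]) > 1" "length (\<phi> [linv x]) > 1"
      using x nonempty[of x] linv[of x] by (auto simp: neq_iff)
    ultimately show ?thesis unfolding free_def by (meson not_less)
  qed
  have "free (\<psi> w)" if "reduced w" for w
    using that
  proof (induction w)
    case Nil
    show ?case using hom_Nil[OF psi_hom] by (simp add: free_def)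
  next
    case (Cons l w)
    have w: "reduced w" using Cons.prems by (simp add: reduced_Cons)
    have "\<psi> (l # w) = \<psi> [l] \<cdot> \<psi> w"
      using Cons_eq_mul[OF Cons.prems] hom_mul[OF psi_hom r w] by simp
    then show ?case
      using set_mul[OF hom_reduced[OF psi_hom w], of "\<psi> [l]"] free_letter[of l] Cons.IH[OF w]
      by (auto simp: free_def)
  qed
  from this[OF hom_reduced[OF hom r[of x]]] show False
    by (simp add: psi_phi[OF r] free_def)
qed

text \<open>Nielsen's theorem in rank two, combined with the normal form \<open>orbit\<close>: as long as the images of the
  letters can be shortened, induct on their total length; otherwise they are letters.\<close>

theorem iso_orbit:
  assumes "\<phi> \<in> iso F2 F2" "reduced w" shows "orbit w (\<phi> w)"
  using assms
proof (induction "length (\<phi> [La]) + length (\<phi> [Lb])" arbitrary: \<phi> w rule: less_induct)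
  case less
  note iso = less.prems(1)
  have r: "reduced [l]" for l by (simp add: reduced_Cons)
  have hom: "\<phi> \<in> hom F2 F2" using iso iso_hom by blast
  have linv: "\<phi> [linv l] = winv (\<phi> [l])" for l
    using hom_winv[OF hom r[of l]] by simp
  have len_linv: "length (\<phi> [La_inv]) = length (\<phi> [La])" "length (\<phi> [Lb_inv]) = length (\<phi> [Lb])"
    using linv[of La] linv[of Lb] by simp_all
  have size: "length (\<phi> [x]) + length (\<phi> [y]) = length (\<phi> [La]) + length (\<phi> [Lb])"
    if "y \<noteq> x" "y \<noteq> linv x" for x y
    using that by (cases x; cases y) (simp_all add: len_linv)
  show ?case
  proof (cases "short_basis (\<lambda>l. \<phi> [l])")
    case True
    obtain p q where pq: "\<phi> [La] = [p]" "\<phi> [Lb] = [q]"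
      using short_iso_letters[OF iso True] by (metis One_nat_def length_0_conv length_Suc_conv)
    have "q \<noteq> p" using iso_inj[OF iso r r, of La Lb] pq by auto
    moreover have "q \<noteq> linv p" using iso_inj[OF iso r r, of La_inv Lb] pq linv[of La] by auto
    ultimately have s: "letter_sym (perm_of p q)" by (rule letter_sym_perm_of)
    have "\<phi> w = map (perm_of p q) w"
      using hom_eq_on_basis[OF hom map_in_hom[OF s]] pq less.prems(2) by simp
    then show ?thesis using orbit_map[OF orbit_refl s] less.prems(2) by simp
  next
    case False
    have ne: "\<phi> [l] \<noteq> []" for l
      using iso_inj[OF iso r[of l] reduced_Nil] hom_Nil[OF hom] by simp
    obtain x y g where xy: "y \<noteq> x" "y \<noteq> linv x" "reduced g" and
      "length (conj_by g (\<phi> [x] \<cdot> \<phi> [y])) + length (conj_by g (\<phi> [y])) < length (\<phi> [x]) + length (\<phi> [y])"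
      using False linv ne hom_reduced[OF hom r] unfolding short_basis_def by (metis not_le)
    moreover define t where "t = perm_of x y"
    moreover define \<psi> where "\<psi> = conj_by g \<circ> (\<phi> \<circ> (map t \<circ> nielsen))"
    moreover have t: "letter_sym t" unfolding t_def using xy by (intro letter_sym_perm_of)
    moreover have "\<phi> [x, y] = \<phi> [x] \<cdot> \<phi> [y]"
      using Cons_eq_mul[of x "[y]"] hom_mul[OF hom r r] xy by (simp add: reduced_Cons)
    ultimately have "length (\<psi> [La]) + length (\<psi> [Lb]) < length (\<phi> [La]) + length (\<phi> [Lb])"
      using size[OF xy(1,2)] by (simp add: nielsen_def reduce_def)
    moreover have "\<psi> \<in> iso F2 F2"
      unfolding \<psi>_def by (intro comp_in_iso conj_by_iso[OF xy(3)] map_iso[OF t] nielsen_iso iso)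
    ultimately have "orbit v (\<psi> v)" if "reduced v" for v using less.hyps that by blast
    then show ?thesis
      using orbit_precompose[OF t xy(3) hom less.prems(2)] by (simp add: \<psi>_def)
  qed
qed

section \<open>Minimal words and root words\<close>

text \<open>A minimal word is locally minimal because each of the four steps is an automorphism. The converse
  is convexity.\<close>

lemma minimal_iff: "minimal w \<longleftrightarrow> w \<in> C2 \<and> locally_minimal w"
proof
  assume min: "minimal w"
  then have r: "reduced w" by (simp add: minimal_def carrier_F2)
  have le: "length w \<le> cyclen (\<phi> w)" if "\<phi> \<in> iso F2 F2" for \<phi>
  proof -
    have "reduced (\<phi> w)" using hom_reduced iso_hom that r by blast
    then obtain u where "conjugate (\<phi> w) u" "length u = cyclen (\<phi> w)" using cyclen_attained by blast
    then obtain g where "reduced g" "u = conj_by g (\<phi> w)" "length u = cyclen (\<phi> w)"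
      by (auto simp: conjugate_def)
    then show ?thesis
      using min comp_in_iso[OF conj_by_iso that] unfolding minimal_def by fastforce
  qed
  have C2: "w \<in> C2"
  proof (rule ccontr)
    assume "w \<notin> C2"
    then obtain u where "conjugate w u" "length u < length w" using strip_ends r by blast
    then have "cyclen (map id w) < length w" using cyclen_le[of w u] by simp
    then show False using le[OF map_iso[OF letter_sym_id]] by simp
  qed
  have "gain (map s w) \<ge> 0" if s: "letter_sym s" for s
  proof -
    have "(nielsen \<circ> map s) \<in> iso F2 F2" using comp_in_iso nielsen_iso map_iso[OF s] by blast
    from le[OF this] show ?thesis
      using C2 r by (simp add: gain_def cyclen_map[OF s] cyclen_C2)
  qed
  \<comment> \<open>these four symmetries give the gains \<open>A + d\<close>, \<open>A - d\<close>, \<open>B + d\<close> and \<open>B - d\<close>\<close>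
  from this[OF letter_sym_id] this[OF letter_sym_flip] this[OF letter_sym_swap] this[OF letter_sym_comp[OF letter_sym_flip letter_sym_swap]]
  show "w \<in> C2 \<and> locally_minimal w"
    using C2 gain_C2[OF C2] by (simp add: locally_minimal_def abs_le_iff)
next
  assume w: "w \<in> C2 \<and> locally_minimal w"
  have "length w \<le> length (\<phi> w)" if "\<phi> \<in> iso F2 F2" for \<phi>
  proof -
    have r: "reduced w" "reduced (\<phi> w)" using w C2_reduced hom_reduced iso_hom that by blast+
    have "length w \<le> cyclen (\<phi> w)" using locally_minimal_orbit iso_orbit that w r by blast
    also have "\<dots> \<le> length (\<phi> w)" using cyclen_le r by simp
    finally show ?thesis .
  qed
  then show "minimal w" using w C2_reduced by (simp add: minimal_def carrier_F2)
qed

text \<open>Doubling a letter \<open>x\<close> inserts one adjacent pair \<open>xx\<close> and keeps all other pairs.\<close>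

lemma counts_double_at:
  assumes "i < length w"
  shows "num_aa (double_at i w) = num_aa w + of_bool (w ! i \<in> {La, La_inv})"
    "num_bb (double_at i w) = num_bb w + of_bool (w ! i \<in> {Lb, Lb_inv})"
    "skew (double_at i w) = skew w"
proof -
  define x where "x = w ! i"
  define zs where "zs = drop (Suc i) w @ take i w"
  have w: "w = take i w @ x # drop (Suc i) w" using assms by (simp add: x_def id_take_nth_drop)
  have d: "double_at i w = take i w @ x # x # drop (Suc i) w"
    using assms by (simp add: double_at_def x_def Cons_nth_drop_Suc)
  have rot: "rotate i w = x # zs" "rotate i (double_at i w) = x # x # zs"
    using assms rotate_append[of "take i w" "x # drop (Suc i) w"] rotate_append[of "take i w" "x # x # drop (Suc i) w"] w
    by (simp_all add: d zs_def)
  have "cyc_count p q (double_at i w) = cyc_count p q w + of_bool (p = x \<and> q = x)" for p q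
  proof -
    have "cyc_count p q (double_at i w) = cyc_count p q (x # x # zs)"
      using cyc_count_rotate[of p q i "double_at i w"] rot by simp
    also have "\<dots> = cyc_count p q (x # zs) + of_bool (p = x \<and> q = x)"
      by (auto simp: cyc_count_def cyc_pairs_double)
    also have "cyc_count p q (x # zs) = cyc_count p q w"
      using cyc_count_rotate[of p q i w] rot by simp
    finally show ?thesis .
  qed
  then show "num_aa (double_at i w) = num_aa w + of_bool (w ! i \<in> {La, La_inv})"
    "num_bb (double_at i w) = num_bb w + of_bool (w ! i \<in> {Lb, Lb_inv})"
    "skew (double_at i w) = skew w"
    unfolding num_aa_def num_bb_def skew_def x_def[symmetric] by (cases x; simp)+
qed

text \<open>The children of the empty word follow the same rule as the others, since a cyclic word of length
  one is adjacent to itself.\<close>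

lemma counts_child:
  assumes "is_child u w"
  obtains "skew u = skew w" "num_aa u = num_aa w + 1" "num_bb u = num_bb w"
  | "skew u = skew w" "num_aa u = num_aa w" "num_bb u = num_bb w + 1"
proof (cases "w = []")
  case True
  then obtain x where "u = [x]" using assms by (auto simp: is_child_def)
  then show ?thesis using True that
    by (cases x) (simp_all add: skew_def num_aa_def num_bb_def cyc_count_def cyc_pairs_def)
next
  case False
  then obtain m n i where i: "i < length w" "rotate m u = double_at i (rotate n w)"
    using assms by (auto simp: is_child_def)
  have rot: "skew (rotate k v) = skew v" "num_aa (rotate k v) = num_aa v" "num_bb (rotate k v) = num_bb v" for k v
    by (simp_all add: skew_def num_aa_def num_bb_def)
  have "i < length (rotate n w)" using i by simp
  from counts_double_at[OF this] show ?thesis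
    using that unfolding i(2)[symmetric] rot by (cases "rotate n w ! i") simp_all
qed

text \<open>A repeated letter can be undoubled, so the word is a child. If it has length one, the pair \<open>xx\<close>
  consists of the same letter twice and the parent is the empty word.\<close>

lemma repeated_letter_child:
  assumes "w \<in> C2" "cyc_count x x w > 0" obtains u where "is_child w u"
    "\<And>y z. cyc_count y z w = cyc_count y z u + of_bool (y = x \<and> z = x)"
proof -
  have "(x, x) \<in> set (cyc_pairs w)"
    using assms(2) count_notin by (force simp: cyc_count_def)
  then obtain i where i: "i < length w" "cyc_pairs w ! i = (x, x)"
    by (metis in_set_conv_nth length_cyc_pairs)
  define v where "v = rotate i w"
  have "v \<noteq> []" using i by (auto simp: v_def)
  have "hd (cyc_pairs v) = (x, x)"
    using i hd_rotate_conv_nth[of "cyc_pairs w" i] by (simp add: v_def cyc_pairs_rotate flip: length_greater_0_conv)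
  then have cases: "v = [x] \<or> (\<exists>u. v = x # x # u)"
    using \<open>v \<noteq> []\<close> by (cases v; cases "tl v") (auto simp: cyc_pairs_def)
  then obtain u where u: "v = x # u" and "u = [] \<or> (\<exists>u'. u = x # u')" by auto
  have v: "v \<in> C2" using assms by (simp add: v_def)
  have count: "cyc_count y z w = cyc_count y z u + of_bool (y = x \<and> z = x)" for y z
  proof -
    have "cyc_count y z v = cyc_count y z u + of_bool (y = x \<and> z = x)"
      using cases u by (auto simp: cyc_count_def cyc_pairs_double) (auto simp: cyc_pairs_def)
    then show ?thesis by (simp add: v_def)
  qed
  have uC: "u \<in> C2"
    using v cases u by (auto simp: C2_iff_pairs cyc_pairs_double) (auto simp: cyc_pairs_def)
  have "is_child w u"
  proof (cases "u = []")
    case True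
    then have "length w = 1" using u unfolding v_def by (metis length_rotate length_Cons list.size(3) One_nat_def)
    then show ?thesis using True uC assms by (auto simp: is_child_def length_Suc_conv)
  next
    case False
    then obtain u' where "u = x # u'" using cases u by auto
    then have "rotate i w = double_at 0 (rotate 0 u)" using u by (simp add: v_def double_at_def)
    moreover have "0 < length u" using False by simp
    ultimately show ?thesis
      unfolding is_child_def using False uC assms(1) by (metis (no_types))
  qed
  then show ?thesis using that count by blast
qed

text \<open>If \<open>A > \<bar>d\<bar>\<close>, then some \<open>aa\<close> or its inverse can be undoubled without losing local minimality, and
  the same holds for \<open>B\<close>. Conversely, if \<open>A = B = \<bar>d\<bar>\<close>, then a parent would have \<open>A\<close> or \<open>B\<close> below
  \<open>\<bar>d\<bar>\<close>.\<close>

lemma root_word_iff: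
  "root_word w \<longleftrightarrow> w \<in> C2 \<and> num_aa w = \<bar>skew w\<bar> \<and> num_bb w = \<bar>skew w\<bar>"
proof
  assume root: "root_word w"
  then have w: "w \<in> C2" "locally_minimal w" and
    no: "\<And>u. minimal u \<Longrightarrow> \<not> is_child w u"
    by (auto simp: root_word_def minimal_iff)
  have not_min: "\<not> locally_minimal u" if "is_child w u" for u
    using no[of u] that by (auto simp: minimal_iff is_child_def)
  have tight: "\<not> cyc_count x x w > 0"
    if lt: "\<bar>skew w\<bar> < (if x \<in> {La, La_inv} then num_aa w else num_bb w)" for x
  proof
    assume "cyc_count x x w > 0"
    then obtain u where "is_child w u"
      "\<And>y z. cyc_count y z w = cyc_count y z u + of_bool (y = x \<and> z = x)"
      using repeated_letter_child[OF w(1)] by metis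
    then show False using not_min[of u] lt w(2)
      by (cases x) (simp_all add: locally_minimal_def num_aa_def num_bb_def skew_def)
  qed
  have "num_aa w \<le> \<bar>skew w\<bar>"
    using tight[of La] tight[of La_inv] by - (rule ccontr, simp add: num_aa_def)
  moreover have "num_bb w \<le> \<bar>skew w\<bar>"
    using tight[of Lb] tight[of Lb_inv] by - (rule ccontr, simp add: num_bb_def)
  ultimately show "w \<in> C2 \<and> num_aa w = \<bar>skew w\<bar> \<and> num_bb w = \<bar>skew w\<bar>"
    using w by (auto simp: locally_minimal_def)
next
  assume w: "w \<in> C2 \<and> num_aa w = \<bar>skew w\<bar> \<and> num_bb w = \<bar>skew w\<bar>"
  have "\<not> is_child w u" if "minimal u" for u
  proof
    assume "is_child w u"
    then show False using that w by (cases rule: counts_child) (auto simp: minimal_iff locally_minimal_def)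
  qed
  then show "root_word w" using w by (auto simp: root_word_def minimal_iff locally_minimal_def)
qed

theorem theorem16:
  fixes w v :: word
  assumes "w \<in> carrier F2"
    and "v \<in> carrier F2"
    and "root_word w"
    and "aut_equiv w v"
    and "length w = length v"
  shows "root_word v"
proof -
  obtain \<phi> where phi: "\<phi> \<in> iso F2 F2" "\<phi> w = v" using assms(4) by (auto simp: aut_equiv_def)
  have w: "w \<in> C2" "locally_minimal w" and min: "minimal w"
    using assms(3) by (auto simp: root_word_def minimal_iff)
  have "minimal v"
    using min assms(2,5) phi comp_in_iso[OF _ phi(1)] unfolding minimal_def by fastforce
  then have v: "v \<in> C2" by (simp add: minimal_iff)
  have "triangular w"
    using assms(3) triangular_C2[OF w(1)] by (simp add: root_word_iff)
  moreover have "orbit w v" using iso_orbit[OF phi(1)] phi(2) w C2_reduced by blast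
  ultimately have "triangular v"
    using triangular_orbit w assms(5) v by (simp add: cyclen_C2)
  then show ?thesis
    using v triangular_C2[OF v] by (simp add: root_word_iff)
qed

end
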